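(* Let $\rho(x)=\max(0,x)$, and let $d\ge 14$. For a data set $\mathcal{D}=((x_i,y_i))_{i=1}^d\in(\mathbb{R}_c^3\times\mathbb{R}_c)^d$ consider the minimization problem $$\min_{\Phi\in\mathbb{R}_c^{3\times 3}}\ \sum_{i=1}^d\Big(\sum_{k=1}^3\rho\big((\Phi x_i)_k\big)-y_i\Big)^2,$$ and let $\mathrm{Opt}(\mathcal{D})\subset\mathbb{R}_c^{3\times3}$ be its set of minimizers. Let $G:(\mathbb{R}_c^3\times\mathbb{R}_c)^d\to\mathbb{R}_c^{3\times3}$ be a function with $G(\mathcal{D})\in\mathrm{Opt}(\mathcal{D})$ for all $\mathcal{D}\in(\mathbb{R}_c^3\times\mathbb{R}_c)^d$. Then $G$ is not Banach-Mazur computable. Moreover, every function $G^*:(\mathbb{R}_c^3\times\mathbb{R}_c)^d\to\mathbb{R}_c^{3\times3}$ satisfying $\|G-G^*\|_\infty\le\alpha$ for some $\alpha<4$ is also not Banach-Mazur computable.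
   Context: A function $\mathbb{N}\to\mathbb{N}$ is recursive if it is computed by a Turing machine (similarly for several arguments). A sequence of rationals $(r_k)$ is computable if there are recursive $s,p,q:\mathbb{N}\to\mathbb{N}$ (with $q$ nonvanishing) such that $r_k=(-1)^{s(k)}\frac{p(k)}{q(k)}$ for all $k$; analogously for double sequences. A real number $x$ is computable if there is a computable rational sequence $(q_n)$ with $|q_n-x|\le2^{-n}$ for all $n$; $\mathbb{R}_c$ denotes the set of computable reals. A real sequence $(x_n)$ is computable if there is a computable rational double sequence $(q_{n,k})$ with $|q_{n,k}-x_n|\le 2^{-k}$ for all $n,k$. These notions extend componentwise to vectors and matrices. A function $f$ from a subset of $\mathbb{R}_c^N$ to $\mathbb{R}_c^M$ is Banach-Mazur computable if for every computable sequence $(a_n)$ in the domain, the sequence $(f(a_n))$ is computable. The data space is identified with $\mathbb{R}_c^{4d}$ and $\mathbb{R}_c^{3\times3}$ with $\mathbb{R}_c^9$. The function $x\mapsto\sum_{k=1}^3\rho((\Phi x)_k)$ is the ReLU network with layer widths $3,3,1$, without biases, with first weight matrix $\Phi$ and all weights of the last layer equal to $1$. $\|G-G^*\|_\infty=\sup_{\mathcal{D}}\|G(\mathcal{D})-G^*(\mathcal{D})\|_1$, where $\|\cdot\|_1$ is the entrywise $\ell^1$-norm on $3\times3$ matrices. *)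

theory Defs
  imports "HOL-Analysis.Analysis"
begin

section \<open>Turing machines and recursive functions\<close>

text \<open>
  A machine is a finite program of entries ((q, a), (q', b, d)): in state q reading the symbol a,
  print b, go to state q' and move the head as told by d. It halts when no entry applies.
  States and symbols are natural numbers; a program mentions only finitely many of them. If
  several entries have the same key (q, a), only the first one counts, so machines are
  deterministic. There is one two-way infinite tape; 0 is the blank, 1 is the stroke, and the
  initial state is 0.
\<close>

datatype move = Move_Left | Stay | Move_Right

type_synonym tm = "((nat \<times> nat) \<times> (nat \<times> nat \<times> move)) list"

type_synonym config = "nat \<times> int \<times> (int \<Rightarrow> nat)"  \<comment> \<open>state, head position, tape contents\<close>

fun move_head :: "move \<Rightarrow> int \<Rightarrow> int" where
  "move_head Move_Left h = h - 1"
| "move_head Stay h = h"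
| "move_head Move_Right h = h + 1"

inductive tm_step :: "tm \<Rightarrow> config \<Rightarrow> config \<Rightarrow> bool" for M :: tm where
  "map_of M (q, t h) = Some (q', b, d) \<Longrightarrow>
    tm_step M (q, h, t) (q', move_head d h, t(h := b))"

definition tm_halted :: "tm \<Rightarrow> config \<Rightarrow> bool" where
  "tm_halted M = (\<lambda>(q, h, t). map_of M (q, t h) = None)"

text \<open>
  The arguments are written in unary, n as a block of n + 1 strokes, consecutive blocks being
  separated by one blank; the head starts on the first stroke. The result is the number of strokes
  on the tape when the machine halts.
\<close>

fun unary_word :: "nat list \<Rightarrow> nat list" where
  "unary_word [] = []"
| "unary_word [n] = replicate (Suc n) 1"
| "unary_word (n # ns) = replicate (Suc n) 1 @ 0 # unary_word ns"

definition input_tape :: "nat list \<Rightarrow> int \<Rightarrow> nat" where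
  "input_tape ns i =
     (if 0 \<le> i \<and> nat i < length (unary_word ns) then unary_word ns ! nat i else 0)"

definition tm_computes :: "tm \<Rightarrow> nat list \<Rightarrow> nat \<Rightarrow> bool" where
  "tm_computes M ns v \<longleftrightarrow>
     (\<exists>q h t. (tm_step M)\<^sup>*\<^sup>* (0, 0, input_tape ns) (q, h, t) \<and> tm_halted M (q, h, t) \<and>
              card {i. t i = 1} = v)"

definition recursive1 :: "(nat \<Rightarrow> nat) \<Rightarrow> bool" where
  "recursive1 f \<longleftrightarrow> (\<exists>M. \<forall>n. tm_computes M [n] (f n))"

definition recursive2 :: "(nat \<Rightarrow> nat \<Rightarrow> nat) \<Rightarrow> bool" where
  "recursive2 f \<longleftrightarrow> (\<exists>M. \<forall>m n. tm_computes M [m, n] (f m n))"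


section \<open>Computable reals and Banach-Mazur computability\<close>

definition computable_rat_seq :: "(nat \<Rightarrow> rat) \<Rightarrow> bool" where
  "computable_rat_seq r \<longleftrightarrow>
     (\<exists>s p q. recursive1 s \<and> recursive1 p \<and> recursive1 q \<and> (\<forall>k. q k \<noteq> 0) \<and>
              (\<forall>k. r k = (- 1) ^ s k * (of_nat (p k) / of_nat (q k))))"

definition computable_rat_double_seq :: "(nat \<Rightarrow> nat \<Rightarrow> rat) \<Rightarrow> bool" where
  "computable_rat_double_seq r \<longleftrightarrow>
     (\<exists>s p q. recursive2 s \<and> recursive2 p \<and> recursive2 q \<and> (\<forall>n k. q n k \<noteq> 0) \<and>
              (\<forall>n k. r n k = (- 1) ^ s n k * (of_nat (p n k) / of_nat (q n k))))"

definition computable_real :: "real \<Rightarrow> bool" where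
  "computable_real x \<longleftrightarrow>
     (\<exists>r. computable_rat_seq r \<and> (\<forall>n. \<bar>of_rat (r n) - x\<bar> \<le> 1 / 2 ^ n))"

definition computable_real_seq :: "(nat \<Rightarrow> real) \<Rightarrow> bool" where
  "computable_real_seq x \<longleftrightarrow>
     (\<exists>r. computable_rat_double_seq r \<and> (\<forall>n k. \<bar>of_rat (r n k) - x n\<bar> \<le> 1 / 2 ^ k))"

text \<open>
  Vectors, matrices and data sets are handled uniformly through their coordinates with respect to
  the standard basis of a Euclidean space. For data sets, the type
  \<^typ>\<open>((real^3) \<times> real)^'d\<close> is thereby identified with the space of real vectors
  with 4d entries, see the lemmas below.
\<close>

definition computable_points :: "'a::euclidean_space set" where
  "computable_points = {x. \<forall>b\<in>Basis. computable_real (x \<bullet> b)}"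

definition computable_seq :: "(nat \<Rightarrow> 'a::euclidean_space) \<Rightarrow> bool" where
  "computable_seq a \<longleftrightarrow> (\<forall>b\<in>Basis. computable_real_seq (\<lambda>n. a n \<bullet> b))"

definition banach_mazur_computable_on ::
    "'a::euclidean_space set \<Rightarrow> ('a \<Rightarrow> 'b::euclidean_space) \<Rightarrow> bool" where
  "banach_mazur_computable_on X f \<longleftrightarrow>
     (\<forall>a. (\<forall>n. a n \<in> X) \<and> computable_seq a \<longrightarrow> computable_seq (\<lambda>n. f (a n)))"

lemma computable_points_matrix_iff:
  fixes A :: "real^'n^'m"
  shows "A \<in> computable_points \<longleftrightarrow> (\<forall>i j. computable_real (A $ i $ j))"
  by (auto simp: computable_points_def Basis_vec_def inner_axis)

lemma computable_seq_matrix_iff: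
  fixes A :: "nat \<Rightarrow> real^'n^'m"
  shows "computable_seq A \<longleftrightarrow> (\<forall>i j. computable_real_seq (\<lambda>n. A n $ i $ j))"
  by (auto simp: computable_seq_def Basis_vec_def inner_axis)

lemma computable_points_data_iff:
  fixes D :: "((real^'n) \<times> real)^'d"
  shows "D \<in> computable_points \<longleftrightarrow>
    (\<forall>i. (\<forall>j. computable_real (fst (D $ i) $ j)) \<and> computable_real (snd (D $ i)))"
  by (auto simp: computable_points_def Basis_vec_def Basis_prod_def inner_axis inner_prod_def
      ball_Un)

lemma computable_seq_data_iff:
  fixes D :: "nat \<Rightarrow> ((real^'n) \<times> real)^'d"
  shows "computable_seq D \<longleftrightarrow>
    (\<forall>i. (\<forall>j. computable_real_seq (\<lambda>n. fst (D n $ i) $ j)) \<and>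
         computable_real_seq (\<lambda>n. snd (D n $ i)))"
  by (auto simp: computable_seq_def Basis_vec_def Basis_prod_def inner_axis inner_prod_def
      ball_Un)


section \<open>The training problem\<close>

definition relu :: "real \<Rightarrow> real" where
  "relu x = max 0 x"

definition loss :: "((real^3) \<times> real)^'d \<Rightarrow> real^3^3 \<Rightarrow> real" where
  "loss D \<Phi> = (\<Sum>i\<in>UNIV. ((\<Sum>k\<in>UNIV. relu ((\<Phi> *v fst (D $ i)) $ k)) - snd (D $ i))\<^sup>2)"

definition Opt :: "((real^3) \<times> real)^'d \<Rightarrow> (real^3^3) set" where
  "Opt D = {\<Phi>. is_arg_min (loss D) (\<lambda>\<Psi>. \<Psi> \<in> computable_points) \<Phi>}"

definition matrix_l1_norm :: "real^'n^'m \<Rightarrow> real" where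
  "matrix_l1_norm A = (\<Sum>i\<in>UNIV. \<Sum>j\<in>UNIV. \<bar>A $ i $ j\<bar>)"

text \<open>The supremum may be infinite, hence the extended reals.\<close>

definition sup_dist ::
    "(((real^3) \<times> real)^'d \<Rightarrow> real^3^3) \<Rightarrow> (((real^3) \<times> real)^'d \<Rightarrow> real^3^3) \<Rightarrow> ereal" where
  "sup_dist G H = (SUP D\<in>computable_points. ereal (matrix_l1_norm (G D - H D)))"

end

theory Submission
  imports Defs "HOL-Library.Nat_Bijection"
begin

text \<open>
  For e > 0 the function 20 (relu s + relu t + relu (-s-t)) + relu (e s) is, up to the order of the
  neurons, a sum of three relus in exactly one way, with directions (20 + e, 0), (0, 20), (-20, -20);
  for e < 0 the directions are (-20 + e, 0), (0, -20), (20, 20). Nine sample points already force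
  this. Hence arbitrarily small perturbations e decide between far apart sets of minimizers, and an
  approximate minimizer reveals the sign of e. A diagonal sequence of numbers e, whose n-th member is
  positive or negative (and tiny) depending on the outcome of running the machines coded by n on n,
  then defeats every computable guess of the sign. That this sequence is computable is shown by
  simulating Turing machines with primitive recursive functions, which are compiled to counter
  programs and these to Turing machines.
\<close>

section \<open>Turing machines running counter programs\<close>

text \<open>At e = 0 the target has two representations: relu s + relu t + relu (-s-t) and relu (-s)
  + relu (-t) + relu (s+t) differ by s + t - (s+t) = 0. With only three neurons, the extra term relu
  (e s) must be absorbed by a neuron already pointing its way, along s for e > 0 and along -s for e
  < 0, so e selects the representation. As neurons may be permuted, the sign of e must be legible in
  any row. The three main directions sum to zero, so no linear functional is positive on all of
  them, and the sign test is joined by a size threshold. The factor 20 makes room for the errors: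
  tolerance below 4, rational error at most 1 and |e| at most 1 still leave sizes near 20 and near
  40 on different sides of 30. The diagonal sequence must also be defined where coded machines never
  halt. Tying the size of a member to the halting time settles this: while nothing has halted, a
  tiny number is a good enough approximation. Simulation makes these approximations primitive
  recursive; compilation turns them into Turing machines, as the definition of recursiveness
  demands.\<close>

definition list_tape :: "nat list \<Rightarrow> int \<Rightarrow> nat" where
  "list_tape xs i = (if 0 \<le> i \<and> nat i < length xs then xs ! nat i else 0)"

lemma list_tape_at: "list_tape (xs @ a # zs) (int (length xs)) = a"
  by (simp add: list_tape_def)

lemma list_tape_end: "list_tape xs (int (length xs)) = 0"
  by (simp add: list_tape_def)

lemma list_tape_before: "list_tape xs (- 1) = 0"
  by (simp add: list_tape_def)

lemma list_tape_update:
  "(list_tape (xs @ a # zs))(int (length xs) := b) = list_tape (xs @ b # zs)"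
  by (auto simp: list_tape_def nth_append fun_eq_iff nth_Cons split: nat.splits)

lemma list_tape_append_blank: "list_tape (xs @ [0]) = list_tape xs"
  by (auto simp: list_tape_def nth_append fun_eq_iff)

lemma list_tape_extend: "(list_tape xs)(int (length xs) := b) = list_tape (xs @ [b])"
  using list_tape_update[of xs 0 "[]" b] by (simp add: list_tape_append_blank)

lemma tm_step_list_tape:
  assumes "map_of M (q, a) = Some (q', b, d)"
  shows "tm_step M (q, int (length xs), list_tape (xs @ a # zs))
    (q', move_head d (int (length xs)), list_tape (xs @ b # zs))"
  using tm_step.intros[of M q "list_tape (xs @ a # zs)" "int (length xs)" q' b d] assms
  by (simp add: list_tape_at list_tape_update)

lemma tm_step_list_tape_end:
  assumes "map_of M (q, 0) = Some (q', b, d)"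
  shows "tm_step M (q, int (length xs), list_tape xs)
    (q', move_head d (int (length xs)), list_tape (xs @ [b]))"
  using tm_step.intros[of M q "list_tape xs" "int (length xs)" q' b d] assms
  by (simp add: list_tape_end list_tape_extend)

text \<open>The rewriting \<open>f\<close> covers three uses: skipping cells (identity), recoding
  the strokes of the input, and printing the result.\<close>

lemma tm_scan_right:
  assumes "\<And>a. a \<in> set ys \<Longrightarrow> map_of M (q, a) = Some (q, f a, Move_Right)"
  shows "(tm_step M)\<^sup>*\<^sup>* (q, int (length xs), list_tape (xs @ ys @ zs))
    (q, int (length xs + length ys), list_tape (xs @ map f ys @ zs))"
  using assms
proof (induction ys arbitrary: xs)
  case (Cons a ys)
  have "tm_step M (q, int (length xs), list_tape (xs @ a # (ys @ zs)))
     (q, int (length (xs @ [f a])), list_tape ((xs @ [f a]) @ ys @ zs))"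
    using tm_step_list_tape[of M q a q "f a" Move_Right xs "ys @ zs"] Cons.prems by (simp add: add.commute)
  also have "(tm_step M)\<^sup>*\<^sup>* (q, int (length (xs @ [f a])), list_tape ((xs @ [f a]) @ ys @ zs))
     (q, int (length (xs @ [f a]) + length ys), list_tape ((xs @ [f a]) @ map f ys @ zs))"
    by (rule Cons.IH) (use Cons.prems in auto)
  finally show ?case by simp
qed simp

text \<open>The blank at position -1 serves as left end marker; the two assumptions together exclude
  blanks within \<open>xs\<close>.\<close>

lemma tm_scan_left:
  assumes "\<And>a. a \<in> set xs \<Longrightarrow> map_of M (q, a) = Some (q, a, Move_Left)"
    and "map_of M (q, 0) = Some (q', 0, Move_Right)"
  shows "(tm_step M)\<^sup>*\<^sup>* (q, int (length xs) - 1, list_tape (xs @ zs)) (q', 0, list_tape (xs @ zs))"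
  using assms
proof (induction xs arbitrary: zs rule: rev_induct)
  case Nil
  have "(list_tape zs)(- 1 := 0) = list_tape zs"
    by (auto simp: list_tape_def)
  then show ?case
    using tm_step.intros[of M q "list_tape zs" "-1" q' 0 Move_Right] Nil.prems
    by (auto simp: list_tape_before)
next
  case (snoc a xs)
  have "tm_step M (q, int (length xs), list_tape (xs @ a # zs))
     (q, int (length xs) - 1, list_tape (xs @ a # zs))"
    using tm_step_list_tape[of M q a q a Move_Left xs zs] snoc.prems by simp
  also have "(tm_step M)\<^sup>*\<^sup>* (q, int (length xs) - 1, list_tape (xs @ a # zs))
     (q', 0, list_tape (xs @ a # zs))"
    by (rule snoc.IH) (use snoc.prems in auto)
  finally show ?case by simp
qed

section \<open>Counter programs and their translation into Turing machines\<close>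

datatype instr = Inc nat nat | Dec nat nat nat

inductive cm_step :: "instr list \<Rightarrow> nat \<times> (nat \<Rightarrow> nat) \<Rightarrow> nat \<times> (nat \<Rightarrow> nat) \<Rightarrow> bool"
  for P :: "instr list" where
  "i < length P \<Longrightarrow> P ! i = Inc r l \<Longrightarrow> cm_step P (i, s) (l, s(r := Suc (s r)))"
| "i < length P \<Longrightarrow> P ! i = Dec r l l' \<Longrightarrow> s r = 0 \<Longrightarrow> cm_step P (i, s) (l, s)"
| "i < length P \<Longrightarrow> P ! i = Dec r l l' \<Longrightarrow> s r = Suc v \<Longrightarrow> cm_step P (i, s) (l', s(r := v))"

text \<open>
  The Turing machine of a counter program keeps a contiguous list of non-blank cells starting at
  position 0. The symbol r + 2 in a cell contributes one unit to register r and 1 marks an unused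
  cell. In state 2l + 2 instruction l is executed on the way to the right, in state 2l + 3 the head
  returns to position 0. The program counter \<^term>\<open>length P\<close> prints the contents of
  register 2. The states 0 and 1 read the arguments into the registers 0 and 1, where they arrive
  incremented by one.
\<close>

definition cm_delta :: "instr list \<Rightarrow> nat \<Rightarrow> nat \<Rightarrow> (nat \<times> nat \<times> move) option" where
  "cm_delta P q a =
    (if q = 0 then Some (if a = 0 then (1, 1, Move_Right) else (0, 2, Move_Right))
     else if q = 1 then Some (if a = 0 then (3, 0, Move_Left) else (1, 3, Move_Right))
     else if odd q then Some (if a = 0 then (q - 1, 0, Move_Right) else (q, a, Move_Left))
     else let l = q div 2 - 1 in
       if l < length P then
         (case P ! l of
            Inc r l' \<Rightarrow> Some (if a = 0 then (2 * l' + 3, r + 2, Move_Left) else (q, a, Move_Right))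
          | Dec r l' l'' \<Rightarrow> Some (if a = 0 then (2 * l' + 3, 0, Move_Left)
              else if a = r + 2 then (2 * l'' + 3, 1, Move_Left) else (q, a, Move_Right)))
       else if a = 0 then None else Some (q, if a = 4 then 1 else 2, Move_Right))"

text \<open>A machine is a finite table, so \<open>cm_delta\<close> is tabulated for states and
  symbols bounded through \<open>K\<close>, which is to bound all registers and labels. The offset 5
  keeps the symbols 3 and 4 of registers 1 and 2 available for every \<open>K\<close>.\<close>

definition cm_tm :: "nat \<Rightarrow> instr list \<Rightarrow> tm" where
  "cm_tm K P = map (\<lambda>k. (k, the (cm_delta P (fst k) (snd k))))
     (filter (\<lambda>k. cm_delta P (fst k) (snd k) \<noteq> None) (List.product [0..<2 * K + 4] [0..<K + 5]))"

lemma map_of_cm_tm: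
  "q < 2 * K + 4 \<Longrightarrow> a < K + 5 \<Longrightarrow> map_of (cm_tm K P) (q, a) = cm_delta P q a"
  unfolding cm_tm_def map_of_map_restrict
  by (cases "cm_delta P q a") (auto simp: restrict_map_def)

fun instr_bounded :: "nat \<Rightarrow> instr \<Rightarrow> bool" where
  "instr_bounded K (Inc r l) \<longleftrightarrow> r < K \<and> l < K"
| "instr_bounded K (Dec r l l') \<longleftrightarrow> r < K \<and> l < K \<and> l' < K"

lemma program_bounded: "\<exists>K > length P. \<forall>p\<in>set P. instr_bounded K p"
proof (induction P)
  case (Cons p P)
  then obtain K where K: "K > length P" "\<forall>p\<in>set P. instr_bounded K p" by blast
  obtain K' where K': "instr_bounded K' p"
  proof (cases p)
    case (Inc r l)
    with that[of "Suc (r + l)"] show ?thesis by simp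
  next
    case (Dec r l l')
    with that[of "Suc (r + l + l')"] show ?thesis by simp
  qed
  have mono: "instr_bounded k x \<Longrightarrow> k \<le> k' \<Longrightarrow> instr_bounded k' x" for k k' x
    by (cases x) auto
  have "K + K' + 1 > length (p # P) \<and> (\<forall>x\<in>set (p # P). instr_bounded (K + K' + 1) x)"
    using K K' by (auto intro: mono)
  then show ?case by blast
qed auto

definition register_of :: "nat list \<Rightarrow> nat \<Rightarrow> nat" where
  "register_of xs r = count_list xs (r + 2)"

lemma register_of_append: "register_of (xs @ ys) r = register_of xs r + register_of ys r"
  by (simp add: register_of_def)

lemma register_of_Cons: "register_of (a # xs) r = (if a = r + 2 then 1 else 0) + register_of xs r"
  by (simp add: register_of_def)

lemma cm_tm_return:
  assumes "set xs \<subseteq> {0<..<K + 5}" "l < K"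
  shows "(tm_step (cm_tm K P))\<^sup>*\<^sup>* (2 * l + 3, int (length xs) - 1, list_tape (xs @ zs))
    (2 * l + 2, 0, list_tape (xs @ zs))"
proof (rule tm_scan_left)
  show "map_of (cm_tm K P) (2 * l + 3, 0) = Some (2 * l + 2, 0, Move_Right)"
    using assms by (subst map_of_cm_tm) (auto simp: cm_delta_def)
  fix a assume "a \<in> set xs"
  then show "map_of (cm_tm K P) (2 * l + 3, a) = Some (2 * l + 3, a, Move_Left)"
    using assms by (subst map_of_cm_tm) (auto simp: cm_delta_def)
qed

lemma cm_tm_step:
  assumes "cm_step P (i, s) (i', s')" "length P < K" "\<forall>p\<in>set P. instr_bounded K p"
    and "set xs \<subseteq> {0<..<K + 5}" "register_of xs = s"
  shows "i' < K \<and> (\<exists>xs'. set xs' \<subseteq> {0<..<K + 5} \<and> register_of xs' = s' \<and>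
    (tm_step (cm_tm K P))\<^sup>*\<^sup>* (2 * i + 2, 0, list_tape xs) (2 * i' + 2, 0, list_tape xs'))"
proof -
  let ?M = "cm_tm K P"
  have iP: "i < length P" using assms(1) by (auto elim: cm_step.cases)
  then have bd: "instr_bounded K (P ! i)" using assms(3) by auto
  have scan: "(tm_step ?M)\<^sup>*\<^sup>* (2 * i + 2, 0, list_tape (ys @ zs))
      (2 * i + 2, int (length ys), list_tape (ys @ zs))"
    if "\<And>a. a \<in> set ys \<Longrightarrow> a < K + 5 \<and> cm_delta P (2 * i + 2) a = Some (2 * i + 2, a, Move_Right)"
    for ys zs
    using tm_scan_right[of ys ?M "2 * i + 2" "\<lambda>a. a" "[]" zs] that iP assms(2)
    by (simp add: map_of_cm_tm)
  from assms(1) show ?thesis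
  proof cases
    case (1 r)
    have sub: "set (xs @ [r + 2]) \<subseteq> {0<..<K + 5}" using assms(4) 1 bd by auto
    have "(tm_step ?M)\<^sup>*\<^sup>* (2 * i + 2, 0, list_tape (xs @ []))
      (2 * i + 2, int (length xs), list_tape (xs @ []))"
      by (rule scan) (use assms(4) 1 in \<open>auto simp: cm_delta_def subset_iff\<close>)
    also have "tm_step ?M (2 * i + 2, int (length xs), list_tape (xs @ []))
      (2 * i' + 3, int (length xs) - 1, list_tape (xs @ [r + 2]))"
      using tm_step_list_tape_end[of ?M "2 * i + 2" "2 * i' + 3" "r + 2" Move_Left xs] 1 iP assms(2)
      by (simp add: map_of_cm_tm cm_delta_def)
    also have "(tm_step ?M)\<^sup>*\<^sup>* (2 * i' + 3, int (length xs) - 1, list_tape (xs @ [r + 2]))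
      (2 * i' + 2, 0, list_tape (xs @ [r + 2]))"
      by (rule cm_tm_return) (use sub 1 bd in auto)
    finally have "(tm_step ?M)\<^sup>*\<^sup>* (2 * i + 2, 0, list_tape xs)
      (2 * i' + 2, 0, list_tape (xs @ [r + 2]))" by simp
    moreover have "register_of (xs @ [r + 2]) = s'"
      using 1 assms(5) by (auto simp: register_of_append register_of_Cons fun_eq_iff) (auto simp: register_of_def)
    ultimately show ?thesis using 1 bd sub by (intro conjI exI[of _ "xs @ [r + 2]"]) auto
  next
    case (2 r l')
    have no: "r + 2 \<notin> set xs"
      using 2 assms(5) by (auto simp: register_of_def count_list_0_iff)
    have "(tm_step ?M)\<^sup>*\<^sup>* (2 * i + 2, 0, list_tape (xs @ []))
      (2 * i + 2, int (length xs), list_tape (xs @ []))"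
      by (rule scan) (use assms(4) 2 no in \<open>auto simp: cm_delta_def subset_iff\<close>)
    also have "tm_step ?M (2 * i + 2, int (length xs), list_tape (xs @ []))
      (2 * i' + 3, int (length xs) - 1, list_tape (xs @ []))"
      using tm_step_list_tape_end[of ?M "2 * i + 2" "2 * i' + 3" 0 Move_Left xs] 2 iP assms(2)
      by (simp add: map_of_cm_tm cm_delta_def list_tape_append_blank)
    also have "(tm_step ?M)\<^sup>*\<^sup>* (2 * i' + 3, int (length xs) - 1, list_tape (xs @ []))
      (2 * i' + 2, 0, list_tape (xs @ []))"
      by (rule cm_tm_return) (use assms(4) 2 bd in auto)
    finally have "(tm_step ?M)\<^sup>*\<^sup>* (2 * i + 2, 0, list_tape xs)
      (2 * i' + 2, 0, list_tape xs)" by simp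
    then show ?thesis using 2 bd assms(4,5) by auto
  next
    case (3 r l' v)
    have "r + 2 \<in> set xs"
      using 3 assms(5) count_list_0_iff[of xs "r + 2"] by (auto simp: register_of_def)
    then obtain ys zs where xs: "xs = ys @ (r + 2) # zs" and no: "r + 2 \<notin> set ys"
      by (meson split_list_first)
    \<comment> \<open>The removed unit leaves the mark 1 instead of a blank, so that the cells in
      use stay contiguous.\<close>
    have sub: "set (ys @ 1 # zs) \<subseteq> {0<..<K + 5}" using assms(4) xs by auto
    have "(tm_step ?M)\<^sup>*\<^sup>* (2 * i + 2, 0, list_tape (ys @ (r + 2) # zs))
      (2 * i + 2, int (length ys), list_tape (ys @ (r + 2) # zs))"
      by (rule scan) (use assms(4) 3 no xs in \<open>auto simp: cm_delta_def subset_iff\<close>)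
    also have "tm_step ?M (2 * i + 2, int (length ys), list_tape (ys @ (r + 2) # zs))
      (2 * i' + 3, int (length ys) - 1, list_tape (ys @ 1 # zs))"
      using tm_step_list_tape[of ?M "2 * i + 2" "r + 2" "2 * i' + 3" 1 Move_Left ys] 3 iP assms(2) bd
      by (simp add: map_of_cm_tm cm_delta_def)
    also have "(tm_step ?M)\<^sup>*\<^sup>* (2 * i' + 3, int (length ys) - 1, list_tape (ys @ 1 # zs))
      (2 * i' + 2, 0, list_tape (ys @ 1 # zs))"
      by (rule cm_tm_return) (use sub 3 bd in auto)
    finally have "(tm_step ?M)\<^sup>*\<^sup>* (2 * i + 2, 0, list_tape xs)
      (2 * i' + 2, 0, list_tape (ys @ 1 # zs))" using xs by simp
    moreover have "register_of (ys @ 1 # zs) = s'"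
    proof
      fix x
      have "register_of xs r = Suc v" "register_of xs x = s x" using 3 assms(5) by auto
      then show "register_of (ys @ 1 # zs) x = s' x"
        using 3 by (auto simp: xs register_of_append register_of_Cons)
    qed
    ultimately show ?thesis using 3 bd sub by (intro conjI exI[of _ "ys @ 1 # zs"]) auto
  qed
qed

lemma cm_tm_run:
  assumes "(cm_step P)\<^sup>*\<^sup>* c c'" "length P < K" "\<forall>p\<in>set P. instr_bounded K p"
    and "set xs \<subseteq> {0<..<K + 5}" "register_of xs = snd c"
  shows "\<exists>xs'. set xs' \<subseteq> {0<..<K + 5} \<and> register_of xs' = snd c' \<and>
    (tm_step (cm_tm K P))\<^sup>*\<^sup>* (2 * fst c + 2, 0, list_tape xs) (2 * fst c' + 2, 0, list_tape xs')"
  using assms(1)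
proof (induction rule: rtranclp_induct)
  case base
  then show ?case using assms by blast
next
  case (step c1 c2)
  then obtain xs1 where xs1: "set xs1 \<subseteq> {0<..<K + 5}" "register_of xs1 = snd c1"
    "(tm_step (cm_tm K P))\<^sup>*\<^sup>* (2 * fst c + 2, 0, list_tape xs) (2 * fst c1 + 2, 0, list_tape xs1)"
    by blast
  obtain xs2 where "set xs2 \<subseteq> {0<..<K + 5}" "register_of xs2 = snd c2"
    "(tm_step (cm_tm K P))\<^sup>*\<^sup>* (2 * fst c1 + 2, 0, list_tape xs1) (2 * fst c2 + 2, 0, list_tape xs2)"
    using cm_tm_step[of P "fst c1" "snd c1" "fst c2" "snd c2" K xs1] step.hyps(2) assms(2,3) xs1
    by auto
  then show ?case using xs1(3) by (meson rtranclp_trans)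
qed

lemma card_list_tape_ones: "card {i. list_tape xs i = 1} = count_list xs 1"
proof -
  have "bij_betw nat {i. list_tape xs i = 1} {i. i < length xs \<and> xs ! i = 1}"
    by (rule bij_betw_byWitness[where f' = int]) (auto simp: list_tape_def split: if_splits)
  then have "card {i. list_tape xs i = 1} = card {i. i < length xs \<and> xs ! i = 1}"
    by (rule bij_betw_same_card)
  also have "\<dots> = length (filter ((=) 1) xs)"
    by (simp add: length_filter_conv_card eq_commute)
  also have "\<dots> = count_list xs 1"
    by (induction xs) auto
  finally show ?thesis .
qed

lemma cm_tm_computes:
  assumes "length P < K" "\<forall>p\<in>set P. instr_bounded K p"
    and input: "input_tape ns = list_tape (replicate m 1 @ 0 # replicate k 1)"
    and run: "(cm_step P)\<^sup>*\<^sup>* (0, (\<lambda>_. 0)(0 := m, 1 := k)) (length P, s)"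
  shows "tm_computes (cm_tm K P) ns (s 2)"
proof -
  let ?M = "cm_tm K P"
  let ?xs = "replicate m 2 @ 1 # replicate k 3 :: nat list"
  have sub: "set ?xs \<subseteq> {0<..<K + 5}" by auto
  have "(tm_step ?M)\<^sup>*\<^sup>* (0, 0, list_tape (replicate m 1 @ 0 # replicate k 1))
     (0, int m, list_tape (replicate m 2 @ 0 # replicate k 1))"
    using tm_scan_right[of "replicate m 1" ?M 0 "\<lambda>_. 2" "[]" "0 # replicate k 1"]
    by (simp add: map_of_cm_tm cm_delta_def)
  also have "tm_step ?M (0, int m, list_tape (replicate m 2 @ 0 # replicate k 1))
     (1, int (Suc m), list_tape (replicate m 2 @ 1 # replicate k 1))"
    using tm_step_list_tape[of ?M 0 0 1 1 Move_Right "replicate m 2" "replicate k 1"]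
    by (simp add: map_of_cm_tm cm_delta_def add.commute)
  also have "(tm_step ?M)\<^sup>*\<^sup>* (1, int (Suc m), list_tape (replicate m 2 @ 1 # replicate k 1))
     (1, int (length ?xs), list_tape ?xs)"
    using tm_scan_right[of "replicate k 1" ?M 1 "\<lambda>_. 3" "replicate m 2 @ [1]" "[]"]
    by (simp add: map_of_cm_tm cm_delta_def)
  also have "tm_step ?M (1, int (length ?xs), list_tape ?xs)
     (3, int (length ?xs) - 1, list_tape ?xs)"
    using tm_step_list_tape_end[of ?M 1 3 0 Move_Left ?xs]
    by (simp only: list_tape_append_blank) (simp add: map_of_cm_tm cm_delta_def)
  also have "(tm_step ?M)\<^sup>*\<^sup>* (3, int (length ?xs) - 1, list_tape ?xs) (2, 0, list_tape ?xs)"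
    using cm_tm_return[OF sub, of 0 P "[]"] assms(1) by (simp add: numeral_2_eq_2)
  finally have init: "(tm_step ?M)\<^sup>*\<^sup>* (0, 0, input_tape ns) (2, 0, list_tape ?xs)"
    by (simp only: input)
  have "register_of ?xs = (\<lambda>_. 0)(0 := m, 1 := k)"
  proof -
    have "count_list (replicate n a) b = (if a = b then n else 0)" for n and a b :: nat
      by (induction n) auto
    then show ?thesis by (auto simp: register_of_def fun_eq_iff)
  qed
  with cm_tm_run[OF run assms(1,2) sub]
  have "\<exists>ys. set ys \<subseteq> {0<..<K + 5} \<and> register_of ys = s \<and>
    (tm_step ?M)\<^sup>*\<^sup>* (2, 0, list_tape ?xs) (2 * length P + 2, 0, list_tape ys)"
    by (simp add: numeral_2_eq_2)
  then obtain ys where ys: "set ys \<subseteq> {0<..<K + 5}" "register_of ys = s"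
    "(tm_step ?M)\<^sup>*\<^sup>* (2, 0, list_tape ?xs) (2 * length P + 2, 0, list_tape ys)"
    by blast
  define zs where "zs = map (\<lambda>a. if a = 4 then 1 else 2 :: nat) ys"
  have "(tm_step ?M)\<^sup>*\<^sup>* (2 * length P + 2, int (length ([] :: nat list)), list_tape ([] @ ys @ []))
    (2 * length P + 2, int (length ([] :: nat list) + length ys), list_tape ([] @ zs @ []))"
    unfolding zs_def
    by (rule tm_scan_right) (use ys assms(1) in \<open>auto simp: map_of_cm_tm cm_delta_def subset_iff\<close>)
  with init ys(3)
  have "(tm_step ?M)\<^sup>*\<^sup>* (0, 0, input_tape ns) (2 * length P + 2, int (length zs), list_tape zs)"
    by (simp add: zs_def)
  moreover have "tm_halted ?M (2 * length P + 2, int (length zs), list_tape zs)"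
    using assms(1) by (simp add: tm_halted_def list_tape_end map_of_cm_tm cm_delta_def)
  moreover have "card {i. list_tape zs i = 1} = s 2"
  proof -
    have "count_list zs 1 = count_list ys 4" unfolding zs_def by (induction ys) auto
    also have "\<dots> = s 2" using ys(2) by (auto simp: register_of_def)
    finally show ?thesis by (simp only: card_list_tape_ones)
  qed
  ultimately show ?thesis unfolding tm_computes_def by blast
qed

section \<open>Functions computed by counter programs\<close>

text \<open>Code fragments are parametrised by their start address b and the address e where they exit.\<close>

definition realizable :: "((nat \<Rightarrow> nat) \<Rightarrow> bool) \<Rightarrow> ((nat \<Rightarrow> nat) \<Rightarrow> nat \<Rightarrow> nat) \<Rightarrow> bool" where
  "realizable I f \<longleftrightarrow> (\<exists>n c. \<forall>b e. length (c b e) = n \<and>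
     (\<forall>P. (\<forall>i<n. b + i < length P \<and> P ! (b + i) = c b e ! i) \<longrightarrow>
       (\<forall>s. I s \<longrightarrow> (cm_step P)\<^sup>*\<^sup>* (b, s) (e, f s))))"

lemma realizable_weaken:
  assumes "realizable I f" "\<And>s. I' s \<Longrightarrow> I s" "\<And>s. I' s \<Longrightarrow> f s = f' s"
  shows "realizable I' f'"
proof -
  obtain n c where c: "\<forall>b e. length (c b e) = n \<and>
     (\<forall>P. (\<forall>i<n. b + i < length P \<and> P ! (b + i) = c b e ! i) \<longrightarrow>
       (\<forall>s. I s \<longrightarrow> (cm_step P)\<^sup>*\<^sup>* (b, s) (e, f s)))"
    using assms(1) unfolding realizable_def by blast
  show ?thesis
    unfolding realizable_def
    by (rule exI[of _ n], rule exI[of _ c]) (use c assms(2,3) in \<open>metis (no_types, lifting)\<close>)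
qed

lemma realizable_inc: "realizable I (\<lambda>s. s(r := Suc (s r)))"
  unfolding realizable_def
  by (rule exI[of _ 1], rule exI[of _ "\<lambda>b e. [Inc r e]"]) (auto intro!: r_into_rtranclp cm_step.intros)

lemma realizable_seq:
  assumes "realizable I f" "realizable J g" "\<And>s. I s \<Longrightarrow> J (f s)"
  shows "realizable I (\<lambda>s. g (f s))"
proof -
  obtain n c where c: "\<And>b e. length (c b e) = n"
     "\<And>b e P s. (\<forall>i<n. b + i < length P \<and> P ! (b + i) = c b e ! i) \<Longrightarrow> I s \<Longrightarrow>
       (cm_step P)\<^sup>*\<^sup>* (b, s) (e, f s)"
    using assms(1) unfolding realizable_def by blast
  obtain n' c' where c': "\<And>b e. length (c' b e) = n'"
     "\<And>b e P s. (\<forall>i<n'. b + i < length P \<and> P ! (b + i) = c' b e ! i) \<Longrightarrow> J s \<Longrightarrow>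
       (cm_step P)\<^sup>*\<^sup>* (b, s) (e, g s)"
    using assms(2) unfolding realizable_def by blast
  show ?thesis
    unfolding realizable_def
  \<comment> \<open>The length of a fragment does not depend on its addresses; hence the exit
    \<open>b + n\<close> of the first one is known before it is generated.\<close>
  proof (rule exI[of _ "n + n'"], rule exI[of _ "\<lambda>b e. c b (b + n) @ c' (b + n) e"], intro allI conjI impI)
    fix b e P s
    show "length (c b (b + n) @ c' (b + n) e) = n + n'" using c c' by simp
    assume P: "\<forall>i<n + n'. b + i < length P \<and> P ! (b + i) = (c b (b + n) @ c' (b + n) e) ! i"
      and I: "I s"
    have "(cm_step P)\<^sup>*\<^sup>* (b, s) (b + n, f s)"
    proof (rule c(2)[OF _ I], intro allI impI)
      fix i assume "i < n"
      then show "b + i < length P \<and> P ! (b + i) = c b (b + n) ! i"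
        using P[rule_format, of i] c(1) by (simp add: nth_append)
    qed
    also have "(cm_step P)\<^sup>*\<^sup>* (b + n, f s) (e, g (f s))"
    proof (rule c'(2)[OF _ assms(3)[OF I]], intro allI impI)
      fix i assume "i < n'"
      then show "b + n + i < length P \<and> P ! (b + n + i) = c' (b + n) e ! i"
        using P[rule_format, of "n + i"] c(1) by (simp add: nth_append add.assoc)
    qed
    finally show "(cm_step P)\<^sup>*\<^sup>* (b, s) (e, g (f s))" .
  qed
qed

text \<open>\<open>\<phi> j\<close> is the state at the loop head after \<open>j\<close> rounds. The
  body starts from it with \<open>r\<close> already decremented and leads to
  \<open>\<phi> (Suc j)\<close>.\<close>

lemma realizable_loop:
  assumes "realizable J g"
    and run: "\<And>s. I s \<Longrightarrow> \<exists>\<phi>. \<phi> 0 = s \<and> \<phi> (s r) = f s \<and> f s r = 0 \<and>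
      (\<forall>j < s r. \<phi> j r = s r - j \<and> J ((\<phi> j)(r := s r - Suc j)) \<and> g ((\<phi> j)(r := s r - Suc j)) = \<phi> (Suc j))"
  shows "realizable I f"
proof -
  obtain n c where c: "\<And>b e. length (c b e) = n"
     "\<And>b e P s. (\<forall>i<n. b + i < length P \<and> P ! (b + i) = c b e ! i) \<Longrightarrow> J s \<Longrightarrow>
       (cm_step P)\<^sup>*\<^sup>* (b, s) (e, g s)"
    using assms(1) unfolding realizable_def by blast
  show ?thesis
    unfolding realizable_def
  proof (rule exI[of _ "Suc n"], rule exI[of _ "\<lambda>b e. Dec r e (Suc b) # c (Suc b) b"], intro allI conjI impI)
    fix b e P s
    show "length (Dec r e (Suc b) # c (Suc b) b) = Suc n" using c by simp
    assume P: "\<forall>i<Suc n. b + i < length P \<and> P ! (b + i) = (Dec r e (Suc b) # c (Suc b) b) ! i"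
      and I: "I s"
    have head: "b < length P" "P ! b = Dec r e (Suc b)" using P[rule_format, of 0] by auto
    have body: "\<forall>i<n. Suc b + i < length P \<and> P ! (Suc b + i) = c (Suc b) b ! i"
      using P[rule_format, of "Suc _"] by auto
    obtain \<phi> where \<phi>: "\<phi> 0 = s" "\<phi> (s r) = f s" "f s r = 0"
      "\<And>j. j < s r \<Longrightarrow> \<phi> j r = s r - j" "\<And>j. j < s r \<Longrightarrow> J ((\<phi> j)(r := s r - Suc j))"
      "\<And>j. j < s r \<Longrightarrow> g ((\<phi> j)(r := s r - Suc j)) = \<phi> (Suc j)"
      using run[OF I] by blast
    have "(cm_step P)\<^sup>*\<^sup>* (b, s) (b, \<phi> j)" if "j \<le> s r" for j
      using that
    proof (induction j)
      case (Suc j)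
      then have "(cm_step P)\<^sup>*\<^sup>* (b, s) (b, \<phi> j)" by simp
      also have "cm_step P (b, \<phi> j) (Suc b, (\<phi> j)(r := s r - Suc j))"
        by (rule cm_step.intros(3)[OF head]) (use \<phi>(4)[of j] Suc.prems in simp)
      also have "(cm_step P)\<^sup>*\<^sup>* (Suc b, (\<phi> j)(r := s r - Suc j)) (b, \<phi> (Suc j))"
        using c(2)[OF body \<phi>(5)[of j]] \<phi>(6)[of j] Suc.prems by simp
      finally show ?case .
    qed (use \<phi> in simp)
    from this[of "s r"] have "(cm_step P)\<^sup>*\<^sup>* (b, s) (b, f s)" by (simp add: \<phi>(2))
    also have "cm_step P (b, f s) (e, f s)" by (rule cm_step.intros(2)[OF head]) (rule \<phi>(3))
    finally show "(cm_step P)\<^sup>*\<^sup>* (b, s) (e, f s)" .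
  qed
qed

lemma realizable_clear: "realizable I (\<lambda>s. s(r := 0))"
proof -
  have run: "(cm_step P)\<^sup>*\<^sup>* (b, s) (e, s(r := 0))"
    if P: "b < length P" "P ! b = Dec r e b" for P b e s
  proof (induction "s r" arbitrary: s)
    case 0
    then have "s(r := 0) = s" by auto
    then show ?case using cm_step.intros(2)[OF P, of s] 0 by (simp add: r_into_rtranclp)
  next
    case (Suc v)
    have "cm_step P (b, s) (b, s(r := v))" by (rule cm_step.intros(3)[OF P]) (use Suc in simp)
    also have "(cm_step P)\<^sup>*\<^sup>* (b, s(r := v)) (e, s(r := v, r := 0))" by (rule Suc.hyps) simp
    finally show ?case by simp
  qed
  show ?thesis
    unfolding realizable_def
    by (rule exI[of _ 1], rule exI[of _ "\<lambda>b e. [Dec r e b]"]) (auto intro!: run)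
qed

lemma realizable_move:
  assumes "x \<noteq> m"
  shows "realizable I (\<lambda>s. s(m := s m + s x, x := 0))"
proof (rule realizable_loop[where r = x, OF realizable_inc[of "\<lambda>_. True" m]])
  fix s :: "nat \<Rightarrow> nat"
  show "\<exists>\<phi>. \<phi> 0 = s \<and> \<phi> (s x) = s(m := s m + s x, x := 0) \<and> (s(m := s m + s x, x := 0)) x = 0 \<and>
    (\<forall>j < s x. \<phi> j x = s x - j \<and> True \<and>
      ((\<phi> j)(x := s x - Suc j))(m := Suc (((\<phi> j)(x := s x - Suc j)) m)) = \<phi> (Suc j))"
    by (rule exI[of _ "\<lambda>j. s(m := s m + j, x := s x - j)"]) (use assms in \<open>auto simp: fun_eq_iff\<close>)
qed

text \<open>A counter can only be read destructively: \<open>x\<close> is emptied into both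
  \<open>m\<close> and \<open>Suc m\<close>, and the second copy refills it.\<close>

lemma realizable_copy:
  assumes "x < m"
  shows "realizable (\<lambda>s. \<forall>i\<ge>m. s i = 0) (\<lambda>s. s(m := s x))"
proof -
  have inc2: "realizable (\<lambda>_. True) (\<lambda>s. (s(m := Suc (s m)))(Suc m := Suc ((s(m := Suc (s m))) (Suc m))))"
    by (rule realizable_seq[OF realizable_inc realizable_inc]) auto
  have "realizable (\<lambda>s. \<forall>i\<ge>m. s i = 0) (\<lambda>s. s(m := s x, Suc m := s x, x := 0))"
  proof (rule realizable_loop[where r = x, OF inc2])
    fix s :: "nat \<Rightarrow> nat" assume "\<forall>i\<ge>m. s i = 0"
    then have "s m = 0" "s (Suc m) = 0" by auto
    then show "\<exists>\<phi>. \<phi> 0 = s \<and> \<phi> (s x) = s(m := s x, Suc m := s x, x := 0) \<and> (s(m := s x, Suc m := s x, x := 0)) x = 0 \<and>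
    (\<forall>j < s x. \<phi> j x = s x - j \<and> True \<and>
      (((\<phi> j)(x := s x - Suc j))(m := Suc (((\<phi> j)(x := s x - Suc j)) m)))(Suc m :=
        Suc ((((\<phi> j)(x := s x - Suc j))(m := Suc (((\<phi> j)(x := s x - Suc j)) m))) (Suc m))) = \<phi> (Suc j))"
      by (intro exI[of _ "\<lambda>j. s(m := j, Suc m := j, x := s x - j)"]) (use assms in \<open>auto simp: fun_eq_iff\<close>)
  qed
  from realizable_seq[OF this realizable_move[of "Suc m" x "\<lambda>_. True"]] assms
  have "realizable (\<lambda>s. \<forall>i\<ge>m. s i = 0) (\<lambda>s. (s(m := s x, Suc m := s x, x := 0))
     (x := (s(m := s x, Suc m := s x, x := 0)) x + (s(m := s x, Suc m := s x, x := 0)) (Suc m), Suc m := 0))"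
    by simp
  then show ?thesis
    by (rule realizable_weaken) (use assms in \<open>auto simp: fun_eq_iff\<close>)
qed

text \<open>
  Variable i of the environment is kept in register \<open>v i\<close>; the registers from m on are work space.
  Admitting every placement v makes the renaming of variables trivial.
\<close>

definition env_computable :: "((nat \<Rightarrow> nat) \<Rightarrow> nat) \<Rightarrow> bool" where
  "env_computable F \<longleftrightarrow> (\<forall>v m. (\<forall>i. v i < m) \<longrightarrow>
     realizable (\<lambda>s. \<forall>i\<ge>m. s i = 0) (\<lambda>s. s(m := F (\<lambda>i. s (v i)))))"

lemma env_computable_var: "env_computable (\<lambda>e. e i)"
  unfolding env_computable_def using realizable_copy by blast

lemma env_computable_zero: "env_computable (\<lambda>e. 0)"
  unfolding env_computable_def using realizable_clear by blast

lemma env_computable_Suc: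
  assumes "env_computable F"
  shows "env_computable (\<lambda>e. Suc (F e))"
  unfolding env_computable_def
proof (intro allI impI)
  fix v :: "nat \<Rightarrow> nat" and m assume v: "\<forall>i. v i < m"
  have "realizable (\<lambda>s. \<forall>i\<ge>m. s i = 0) (\<lambda>s. (s(m := F (\<lambda>i. s (v i))))(m := Suc ((s(m := F (\<lambda>i. s (v i)))) m)))"
    by (rule realizable_seq[OF assms[unfolded env_computable_def, rule_format] realizable_inc[of "\<lambda>_. True"]])
      (use v in auto)
  then show "realizable (\<lambda>s. \<forall>i\<ge>m. s i = 0) (\<lambda>s. s(m := Suc (F (\<lambda>i. s (v i)))))" by simp
qed

lemma env_computable_rename:
  assumes "env_computable F"
  shows "env_computable (\<lambda>e. F (\<lambda>i. e (\<rho> i)))"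
  using assms unfolding env_computable_def by fastforce

lemma realizable_replace:
  "realizable (\<lambda>s. \<forall>i>Suc k. s i = 0) (\<lambda>s. s(m := s (Suc k), Suc k := 0))" if "m < Suc k"
proof -
  have "realizable (\<lambda>s. \<forall>i>Suc k. s i = 0) (\<lambda>s. (s(m := 0))(m := (s(m := 0)) m + (s(m := 0)) (Suc k), Suc k := 0))"
    by (rule realizable_seq[OF realizable_clear realizable_move[of _ _ "\<lambda>_. True"]]) (use that in auto)
  then show ?thesis using that by simp
qed

text \<open>Substitution in de Bruijn style: the value of \<open>F\<close> stays in register
  \<open>m\<close> as variable 0 while \<open>H\<close> works from \<open>Suc m\<close> on; the
  result of \<open>H\<close> then replaces it.\<close>

lemma env_computable_let:
  assumes F: "env_computable F" and H: "env_computable H"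
  shows "env_computable (\<lambda>e. H (case_nat (F e) e))"
  unfolding env_computable_def
proof (intro allI impI)
  fix v :: "nat \<Rightarrow> nat" and m assume v: "\<forall>i. v i < m"
  let ?I = "\<lambda>s. \<forall>i\<ge>m. s i = 0"
  let ?F = "\<lambda>s. F (\<lambda>i. s (v i))"
  let ?v = "case_nat m v"
  have "realizable ?I (\<lambda>s. s(m := ?F s))"
    using F v unfolding env_computable_def by blast
  moreover have "realizable (\<lambda>s. \<forall>i\<ge>Suc m. s i = 0) (\<lambda>s. s(Suc m := H (\<lambda>i. s (?v i))))"
    using H[unfolded env_computable_def, rule_format, of ?v "Suc m"] v
    by (auto split: nat.splits simp: less_Suc_eq)
  ultimately have "realizable ?I (\<lambda>s. (s(m := ?F s))(Suc m := H (\<lambda>i. (s(m := ?F s)) (?v i))))"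
    by (rule realizable_seq) auto
  from realizable_seq[OF this realizable_replace[of m m]]
  have "realizable ?I (\<lambda>s. ((s(m := ?F s))(Suc m := H (\<lambda>i. (s(m := ?F s)) (?v i))))
    (m := ((s(m := ?F s))(Suc m := H (\<lambda>i. (s(m := ?F s)) (?v i)))) (Suc m), Suc m := 0))"
    by simp
  moreover have "(\<lambda>i. (s(m := ?F s)) (?v i)) = case_nat (?F s) (\<lambda>i. s (v i))" for s
    using v by (auto simp: fun_eq_iff less_le split: nat.splits)
  ultimately show "realizable ?I (\<lambda>s. s(m := H (case_nat (?F s) (\<lambda>i. s (v i)))))"
    by (elim realizable_weaken) (auto simp: fun_eq_iff)
qed

text \<open>The registers \<open>m\<close>, \<open>Suc m\<close>, \<open>Suc (Suc m)\<close> hold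
  the accumulator, the round number and the number of rounds to go; \<open>S\<close> works behind
  them.\<close>

lemma env_computable_rec:
  assumes Z: "env_computable Z" and S: "env_computable S" and N: "env_computable N"
  shows "env_computable (\<lambda>e. rec_nat (Z e) (\<lambda>k a. S (case_nat a (case_nat k e))) (N e))"
  unfolding env_computable_def
proof (intro allI impI)
  fix v :: "nat \<Rightarrow> nat" and m assume v: "\<forall>i. v i < m"
  have v': "v i \<noteq> m" "v i \<noteq> Suc m" "v i \<noteq> Suc (Suc m)" "v i < m" for i
    using v[rule_format, of i] by auto
  let ?I = "\<lambda>s. \<forall>i\<ge>m. s i = 0"
  define Zs where "Zs = (\<lambda>s. Z (\<lambda>i. s (v i)))"
  define Ns where "Ns = (\<lambda>s. N (\<lambda>i. s (v i)))"
  define R where "R = (\<lambda>s. rec_nat (Zs s) (\<lambda>k a. S (case_nat a (case_nat k (\<lambda>i. s (v i))))))"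
  define w where "w = case_nat m (case_nat (Suc m) v)"
  have "realizable ?I (\<lambda>s. s(m := Zs s))"
    using Z v unfolding env_computable_def Zs_def by blast
  moreover have "realizable (\<lambda>s. \<forall>i\<ge>Suc (Suc m). s i = 0) (\<lambda>s. s(Suc (Suc m) := Ns s))"
    using N[unfolded env_computable_def, rule_format, of v "Suc (Suc m)"] v'(4)
    unfolding Ns_def by (simp add: less_SucI)
  ultimately have "realizable ?I (\<lambda>s. (s(m := Zs s))(Suc (Suc m) := Ns (s(m := Zs s))))"
    by (rule realizable_seq) auto
  then have init: "realizable ?I (\<lambda>s. s(m := Zs s, Suc (Suc m) := Ns s))"
    by (rule realizable_weaken) (auto simp: Ns_def v' fun_eq_iff)
  let ?J = "\<lambda>s. \<forall>i\<ge>Suc (Suc (Suc m)). s i = 0"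
  let ?S = "\<lambda>s. S (\<lambda>i. s (w i))"
  have "realizable ?J (\<lambda>s. s(Suc (Suc (Suc m)) := ?S s))"
    using S[unfolded env_computable_def, rule_format, of w "Suc (Suc (Suc m))"] v'(4)
    by (simp add: w_def less_SucI split: nat.splits)
  from realizable_seq[OF this realizable_replace[of m "Suc (Suc m)"]]
  have "realizable ?J (\<lambda>s. (s(Suc (Suc (Suc m)) := ?S s))
     (m := (s(Suc (Suc (Suc m)) := ?S s)) (Suc (Suc (Suc m))), Suc (Suc (Suc m)) := 0))"
    by simp
  then have "realizable ?J (\<lambda>s. s(m := ?S s))"
    by (rule realizable_weaken) (auto simp: fun_eq_iff)
  from realizable_seq[OF this realizable_inc[of "\<lambda>_. True" "Suc m"]]
  have body: "realizable ?J (\<lambda>s. s(m := ?S s, Suc m := Suc (s (Suc m))))" by simp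
  let ?L = "\<lambda>s. ?J s \<and> s m = Zs s \<and> s (Suc m) = 0 \<and> s (Suc (Suc m)) = Ns s"
  have loop: "realizable ?L (\<lambda>s. s(m := R s (Ns s), Suc m := Ns s, Suc (Suc m) := 0))"
  proof (rule realizable_loop[where r = "Suc (Suc m)", OF body])
    fix s assume L: "?L s"
    let ?\<phi> = "\<lambda>j. s(m := R s j, Suc m := j, Suc (Suc m) := Ns s - j)"
    have step: "?S ((?\<phi> j)(Suc (Suc m) := x)) = R s (Suc j)" for j x
    proof -
      have "(\<lambda>i. ((?\<phi> j)(Suc (Suc m) := x)) (w i)) = case_nat (R s j) (case_nat j (\<lambda>i. s (v i)))"
        by (auto simp: w_def v' fun_eq_iff split: nat.splits)
      then show ?thesis by (simp add: R_def)
    qed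
    show "\<exists>\<phi>. \<phi> 0 = s \<and> \<phi> (s (Suc (Suc m))) = s(m := R s (Ns s), Suc m := Ns s, Suc (Suc m) := 0) \<and>
      (s(m := R s (Ns s), Suc m := Ns s, Suc (Suc m) := 0)) (Suc (Suc m)) = 0 \<and>
      (\<forall>j<s (Suc (Suc m)). \<phi> j (Suc (Suc m)) = s (Suc (Suc m)) - j \<and>
        ?J ((\<phi> j)(Suc (Suc m) := s (Suc (Suc m)) - Suc j)) \<and>
        ((\<phi> j)(Suc (Suc m) := s (Suc (Suc m)) - Suc j))
          (m := ?S ((\<phi> j)(Suc (Suc m) := s (Suc (Suc m)) - Suc j)),
           Suc m := Suc (((\<phi> j)(Suc (Suc m) := s (Suc (Suc m)) - Suc j)) (Suc m))) = \<phi> (Suc j))"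
    proof (rule exI[of _ ?\<phi>], intro conjI allI impI)
      show "?\<phi> 0 = s" using L by (auto simp: fun_eq_iff R_def)
      fix j assume j: "j < s (Suc (Suc m))"
      show "((?\<phi> j)(Suc (Suc m) := s (Suc (Suc m)) - Suc j))
          (m := ?S ((?\<phi> j)(Suc (Suc m) := s (Suc (Suc m)) - Suc j)),
           Suc m := Suc (((?\<phi> j)(Suc (Suc m) := s (Suc (Suc m)) - Suc j)) (Suc m))) = ?\<phi> (Suc j)"
        unfolding step using L by (auto simp: fun_eq_iff)
    qed (use L in auto)
  qed
  have st: "Zs (s(m := x, Suc (Suc m) := y)) = Zs s" "Ns (s(m := x, Suc (Suc m) := y)) = Ns s"
    "R (s(m := x, Suc (Suc m) := y)) = R s" for s x y
    by (simp_all add: Zs_def Ns_def R_def v')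
  have "realizable ?I (\<lambda>s. (s(m := Zs s, Suc (Suc m) := Ns s))
     (m := R (s(m := Zs s, Suc (Suc m) := Ns s)) (Ns (s(m := Zs s, Suc (Suc m) := Ns s))),
      Suc m := Ns (s(m := Zs s, Suc (Suc m) := Ns s)), Suc (Suc m) := 0))"
    by (rule realizable_seq[OF init loop]) (auto simp: st)
  from realizable_seq[OF this realizable_clear[of "\<lambda>_. True" "Suc m"]]
  have "realizable ?I (\<lambda>s. (s(m := Zs s, Suc (Suc m) := Ns s))
     (m := R s (Ns s), Suc m := Ns s, Suc (Suc m) := 0, Suc m := 0))"
    by (simp add: st)
  then have "realizable ?I (\<lambda>s. s(m := R s (Ns s)))"
    by (rule realizable_weaken) (auto simp: fun_eq_iff)
  then show "realizable ?I (\<lambda>s. s(m := rec_nat (Z (\<lambda>i. s (v i)))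
      (\<lambda>k a. S (case_nat a (case_nat k (\<lambda>i. s (v i))))) (N (\<lambda>i. s (v i)))))"
    by (simp add: R_def Zs_def Ns_def)
qed

text \<open>One tape format serves both arities: a single argument is the case \<open>k = 0\<close>.
  Here \<open>m\<close> and \<open>k\<close> count strokes, so each exceeds the argument it
  represents by one.\<close>

lemma env_computable_tm:
  assumes "env_computable F"
  shows "\<exists>M. \<forall>ns m k. input_tape ns = list_tape (replicate m 1 @ 0 # replicate k 1) \<longrightarrow>
    tm_computes M ns (F (case_nat m (\<lambda>_. k)))"
proof -
  let ?v = "case_nat 0 (\<lambda>_. 1) :: nat \<Rightarrow> nat"
  have "realizable (\<lambda>s. \<forall>i\<ge>2. s i = 0) (\<lambda>s. s(2 := F (\<lambda>i. s (?v i))))"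
    using assms[unfolded env_computable_def, rule_format, of ?v 2] by (simp split: nat.splits)
  then obtain n c where c: "\<And>b e. length (c b e) = n"
     "\<And>b e P s. (\<forall>i<n. b + i < length P \<and> P ! (b + i) = c b e ! i) \<Longrightarrow> (\<forall>i\<ge>2. s i = 0) \<Longrightarrow>
       (cm_step P)\<^sup>*\<^sup>* (b, s) (e, s(2 := F (\<lambda>i. s (?v i))))"
    unfolding realizable_def by blast
  define P where "P = c 0 n"
  obtain K where K: "length P < K" "\<forall>p\<in>set P. instr_bounded K p" using program_bounded by blast
  have "tm_computes (cm_tm K P) ns (F (case_nat m (\<lambda>_. k)))"
    if ns: "input_tape ns = list_tape (replicate m 1 @ 0 # replicate k 1)" for ns m k
  proof -
    let ?s = "(\<lambda>_. 0)(0 := m, 1 := k) :: nat \<Rightarrow> nat"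
    define s' where "s' = ?s(2 := F (\<lambda>i. ?s (?v i)))"
    have "(cm_step P)\<^sup>*\<^sup>* (0, ?s) (n, s')"
      unfolding s'_def by (rule c(2)) (auto simp: P_def c(1))
    then have "tm_computes (cm_tm K P) ns (s' 2)"
      by (intro cm_tm_computes[OF K ns]) (simp only: P_def c(1))
    moreover have "s' 2 = F (case_nat m (\<lambda>_. k))"
      unfolding s'_def by (auto intro!: arg_cong[of _ _ F] split: nat.splits)
    ultimately show ?thesis by simp
  qed
  then show ?thesis by blast
qed

section \<open>Closure under arithmetic, bounded sums and pairing\<close>

lemma env_computable_lift1:
  assumes "env_computable (\<lambda>e. A (e 0))" "env_computable F"
  shows "env_computable (\<lambda>e. A (F e))"
  using env_computable_let[OF assms(2,1)] by simp

lemma env_computable_lift2: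
  assumes "env_computable (\<lambda>e. A (e 0) (e 1))" "env_computable F" "env_computable G"
  shows "env_computable (\<lambda>e. A (F e) (G e))"
proof -
  have "env_computable (\<lambda>e. A (e 1) (e 0))"
    using env_computable_rename[OF assms(1), of "\<lambda>i. 1 - i"] by simp
  from env_computable_let[OF env_computable_rename[OF assms(3), of Suc] this]
  have "env_computable (\<lambda>e. A (e 0) (G (\<lambda>i. e (Suc i))))" by simp
  from env_computable_let[OF assms(2) this] show ?thesis by simp
qed

lemma env_computable_lift3:
  assumes "env_computable (\<lambda>e. A (e 0) (e 1) (e 2))" "env_computable F" "env_computable G" "env_computable H"
  shows "env_computable (\<lambda>e. A (F e) (G e) (H e))"
proof -
  have "env_computable (\<lambda>e. A (e 1) (e 2) (e 0))"
    using env_computable_rename[OF assms(1), of "\<lambda>i. if i = 0 then 1 else if i = 1 then 2 else 0"] by simp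
  from env_computable_let[OF env_computable_rename[OF assms(4), of "\<lambda>i. Suc (Suc i)"] this]
  have "env_computable (\<lambda>e. A (e 0) (e 1) (H (\<lambda>i. e (Suc (Suc i)))))"
    by (simp add: numeral_2_eq_2)
  then have "env_computable (\<lambda>e. A (e 1) (e 0) (H (\<lambda>i. e (Suc (Suc i)))))"
    using env_computable_rename[of "\<lambda>e. A (e 0) (e 1) (H (\<lambda>i. e (Suc (Suc i))))"
      "\<lambda>i. if i = 0 then 1 else if i = 1 then 0 else i"] by simp
  from env_computable_let[OF env_computable_rename[OF assms(3), of Suc] this]
  have "env_computable (\<lambda>e. A (e 0) (G (\<lambda>i. e (Suc i))) (H (\<lambda>i. e (Suc i))))" by simp
  from env_computable_let[OF assms(2) this] show ?thesis by simp
qed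

lemma env_computable_const: "env_computable (\<lambda>e. c)"
  by (induction c) (auto intro: env_computable_zero env_computable_Suc)

lemma env_computable_rec_nat:
  assumes "env_computable Z" "env_computable (\<lambda>e. S (e 0) (e 1) (\<lambda>i. e (Suc (Suc i))))" "env_computable N"
  shows "env_computable (\<lambda>e. rec_nat (Z e) (\<lambda>k a. S k a e) (N e))"
proof -
  have "env_computable (\<lambda>e. S (e 1) (e 0) (\<lambda>i. e (Suc (Suc i))))"
    using env_computable_rename[OF assms(2), of "\<lambda>i. if i = 0 then 1 else if i = 1 then 0 else i"] by simp
  from env_computable_rec[OF assms(1) this assms(3)] show ?thesis by simp
qed

lemma env_computable_add:
  assumes "env_computable F" "env_computable G"
  shows "env_computable (\<lambda>e. F e + G e)"
proof -
  have "env_computable (\<lambda>e. rec_nat (e 0) (\<lambda>k a. Suc a) (e 1))"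
    by (intro env_computable_rec_nat env_computable_Suc env_computable_var)
  moreover have "rec_nat a (\<lambda>k a. Suc a) b = a + b" for a b by (induction b) auto
  ultimately show ?thesis using env_computable_lift2[of "(+)"] assms by simp
qed

lemma env_computable_mult:
  assumes "env_computable F" "env_computable G"
  shows "env_computable (\<lambda>e. F e * G e)"
proof -
  have "env_computable (\<lambda>e. rec_nat 0 (\<lambda>k a. a + e 0) (e 1))"
    by (intro env_computable_rec_nat env_computable_add env_computable_var env_computable_const)
  moreover have "rec_nat 0 (\<lambda>k x. x + a) b = a * b" for a b :: nat by (induction b) auto
  ultimately show ?thesis using env_computable_lift2[of "(*)"] assms by simp
qed

lemma env_computable_power:
  assumes "env_computable F" "env_computable G"
  shows "env_computable (\<lambda>e. F e ^ G e)"
proof -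
  have "env_computable (\<lambda>e. rec_nat 1 (\<lambda>k a. a * e 0) (e 1))"
    by (intro env_computable_rec_nat env_computable_mult env_computable_var env_computable_const)
  moreover have "rec_nat 1 (\<lambda>k x. x * a) b = a ^ b" for a b :: nat by (induction b) auto
  ultimately show ?thesis using env_computable_lift2[of "(^)"] assms by simp
qed

lemma env_computable_diff:
  assumes "env_computable F" "env_computable G"
  shows "env_computable (\<lambda>e. F e - G e)"
proof -
  have "env_computable (\<lambda>e. rec_nat 0 (\<lambda>k a. k) (e 0))"
    by (intro env_computable_rec_nat env_computable_var env_computable_const)
  moreover have "rec_nat 0 (\<lambda>k x. k) a = a - 1" for a :: nat by (cases a) auto
  ultimately have pred: "env_computable (\<lambda>e. F e - 1)" if "env_computable F" for F
    using env_computable_lift1[of "\<lambda>a. a - 1"] that by simp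
  have "env_computable (\<lambda>e. rec_nat (e 0) (\<lambda>k a. a - 1) (e 1))"
    by (intro env_computable_rec_nat pred env_computable_var)
  moreover have "rec_nat a (\<lambda>k a. a - 1) b = a - b" for a b :: nat by (induction b) auto
  ultimately show ?thesis using env_computable_lift2[of "(-)"] assms by simp
qed

lemma env_computable_if:
  assumes "env_computable (\<lambda>e. of_bool (C e))" "env_computable F" "env_computable G"
  shows "env_computable (\<lambda>e. if C e then F e else G e)"
proof -
  have "env_computable (\<lambda>e. of_bool (C e) * F e + (1 - of_bool (C e)) * G e)"
    by (intro env_computable_add env_computable_mult env_computable_diff env_computable_const assms)
  moreover have "of_bool (C e) * F e + (1 - of_bool (C e)) * G e = (if C e then F e else G e)" for e
    by simp
  ultimately show ?thesis by simp
qed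

lemma env_computable_less:
  assumes "env_computable F" "env_computable G"
  shows "env_computable (\<lambda>e. of_bool (F e < G e))"
proof -
  have "env_computable (\<lambda>e. 1 - (1 - (G e - F e)))"
    by (intro env_computable_diff env_computable_const assms)
  moreover have "1 - (1 - (G e - F e)) = of_bool (F e < G e)" for e by auto
  ultimately show ?thesis by simp
qed

lemma env_computable_not:
  assumes "env_computable (\<lambda>e. of_bool (C e))"
  shows "env_computable (\<lambda>e. of_bool (\<not> C e))"
proof -
  have "env_computable (\<lambda>e. 1 - of_bool (C e))"
    by (intro env_computable_diff env_computable_const assms)
  moreover have "1 - of_bool (C e) = (of_bool (\<not> C e) :: nat)" for e by simp
  ultimately show ?thesis by simp
qed

lemma env_computable_and:
  assumes "env_computable (\<lambda>e. of_bool (C e))" "env_computable (\<lambda>e. of_bool (D e))"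
  shows "env_computable (\<lambda>e. of_bool (C e \<and> D e))"
  using env_computable_mult[OF assms] by (simp add: of_bool_conj)

lemma env_computable_eq:
  assumes "env_computable F" "env_computable G"
  shows "env_computable (\<lambda>e. of_bool (F e = G e))"
proof -
  have "env_computable (\<lambda>e. of_bool (\<not> F e < G e \<and> \<not> G e < F e))"
    by (intro env_computable_and env_computable_not env_computable_less assms)
  moreover have "\<not> F e < G e \<and> \<not> G e < F e \<longleftrightarrow> F e = G e" for e by auto
  ultimately show ?thesis by simp
qed

lemma env_computable_sum:
  assumes "env_computable (\<lambda>e. S (e 0) (\<lambda>i. e (Suc i)))" "env_computable N"
  shows "env_computable (\<lambda>e. \<Sum>k<N e. S k e)"
proof -
  have "env_computable (\<lambda>e. rec_nat 0 (\<lambda>k a. a + S k e) (N e))"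
    by (rule env_computable_rec_nat[OF env_computable_const _ assms(2)],
        rule env_computable_add[OF env_computable_var])
      (use env_computable_rename[OF assms(1), of "\<lambda>i. if i = 0 then 0 else Suc i"] in simp)
  moreover have "rec_nat 0 (\<lambda>k a. a + S k e) n = (\<Sum>k<n. S k e)" for e n by (induction n) auto
  ultimately show ?thesis by simp
qed

lemma env_computable_div:
  assumes "env_computable F" "env_computable G"
  shows "env_computable (\<lambda>e. F e div G e)"
proof -
  \<comment> \<open>The quotient of a by b counts the k < a with (k + 1) b \<le> a; the conjunct
    \<open>0 < e 1\<close> produces the value 0 for division by zero.\<close>
  have "env_computable (\<lambda>e. \<Sum>k<e 0. of_bool (0 < e 1 \<and> \<not> e 0 < Suc k * e 1))"
    by (intro env_computable_sum env_computable_and env_computable_not env_computable_less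
      env_computable_mult env_computable_Suc env_computable_const env_computable_var)
  moreover have "(\<Sum>k<a. of_bool (0 < b \<and> \<not> a < Suc k * b)) = a div b" for a b :: nat
  proof (cases "b = 0")
    case False
    have "(\<Sum>k<a. of_bool (0 < b \<and> \<not> a < Suc k * b)) = (\<Sum>k<a. of_bool (k < a div b) :: nat)"
      using False less_eq_div_iff_mult_less_eq[of b "Suc _" a]
      by (intro sum.cong) (simp_all add: not_less Suc_le_eq del: mult_Suc)
    also have "\<dots> = card {k. k < a \<and> k < a div b}"
      by (simp add: Groups_Big.sum_of_bool_eq Collect_conj_eq lessThan_def)
    also have "{k. k < a \<and> k < a div b} = {..<a div b}"
      using div_le_dividend[of a b] by (auto intro: less_le_trans)
    finally show ?thesis by simp
  qed simp
  ultimately show ?thesis using env_computable_lift2[of "(div)"] assms by simp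
qed

lemma env_computable_mod:
  assumes "env_computable F" "env_computable G"
  shows "env_computable (\<lambda>e. F e mod G e)"
proof -
  have "env_computable (\<lambda>e. F e - F e div G e * G e)"
    by (intro env_computable_diff env_computable_mult env_computable_div assms)
  then show ?thesis by (simp add: minus_div_mult_eq_mod)
qed

lemma env_computable_prod_encode:
  assumes "env_computable F" "env_computable G"
  shows "env_computable (\<lambda>e. prod_encode (F e, G e))"
proof -
  have "env_computable (\<lambda>e. (F e + G e) * Suc (F e + G e) div 2 + F e)"
    by (intro env_computable_add env_computable_mult env_computable_div env_computable_Suc
      env_computable_const assms)
  then show ?thesis by (simp add: prod_encode_def triangle_def)
qed

text \<open>Decoding by exhaustive search: both components are at most \<open>n\<close>, and
  injectivity of the pairing leaves at most one nonzero summand.\<close>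

lemma prod_decode_sum:
  "(\<Sum>a<Suc n. \<Sum>b<Suc n. if prod_encode (a, b) = n then f (a, b) else 0) = f (prod_decode n)"
proof -
  obtain x y where xy: "prod_decode n = (x, y)" by fastforce
  then have n: "prod_encode (x, y) = n" using prod_decode_inverse[of n] by simp
  then have le: "x < Suc n" "y < Suc n"
    using le_prod_encode_1[of x y] le_prod_encode_2[of y x] by auto
  have "prod_encode (a, b) = n \<longleftrightarrow> (a = x \<and> b = y)" for a b
    unfolding n[symmetric] by (auto dest: injD[OF inj_prod_encode])
  then have "(\<Sum>a<Suc n. \<Sum>b<Suc n. if prod_encode (a, b) = n then f (a, b) else 0)
    = (\<Sum>a<Suc n. if a = x then \<Sum>b<Suc n. if b = y then f (a, b) else 0 else 0)"
    by (intro sum.cong) auto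
  also have "\<dots> = f (x, y)" using le by (simp add: sum.delta)
  finally show ?thesis by (simp add: xy)
qed

lemma env_computable_prod_decode:
  assumes "env_computable F"
  shows "env_computable (\<lambda>e. fst (prod_decode (F e)))" "env_computable (\<lambda>e. snd (prod_decode (F e)))"
proof -
  have "env_computable (\<lambda>e. \<Sum>a<Suc (e 0). \<Sum>b<Suc (e 0). if prod_encode (a, b) = e 0 then a else 0)"
    by (intro env_computable_sum env_computable_if env_computable_eq env_computable_prod_encode
      env_computable_Suc env_computable_const env_computable_var)
  then have "env_computable (\<lambda>e. fst (prod_decode (e 0)))"
    by (simp only: prod_decode_sum[of _ fst, unfolded fst_conv])
  from env_computable_lift1[OF this assms] show "env_computable (\<lambda>e. fst (prod_decode (F e)))" .
  have "env_computable (\<lambda>e. \<Sum>a<Suc (e 0). \<Sum>b<Suc (e 0). if prod_encode (a, b) = e 0 then b else 0)"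
    by (intro env_computable_sum env_computable_if env_computable_eq env_computable_prod_encode
      env_computable_Suc env_computable_const env_computable_var)
  then have "env_computable (\<lambda>e. snd (prod_decode (e 0)))"
    by (simp only: prod_decode_sum[of _ snd, unfolded snd_conv])
  from env_computable_lift1[OF this assms] show "env_computable (\<lambda>e. snd (prod_decode (F e)))" .
qed

section \<open>Passage to recursive functions\<close>

lemma env_computable_recursive2:
  assumes "env_computable (\<lambda>e. f (e 0) (e 1))"
  shows "recursive2 f"
proof -
  have "env_computable (\<lambda>e. f (e 0 - 1) (e 1 - 1))"
    by (intro env_computable_lift2[OF assms] env_computable_diff env_computable_var env_computable_const)
  from env_computable_tm[OF this] obtain M where
    M: "\<And>ns m k. input_tape ns = list_tape (replicate m 1 @ 0 # replicate k 1) \<Longrightarrow>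
      tm_computes M ns (f (m - 1) (k - 1))"
    by auto
  have "tm_computes M [m, n] (f m n)" for m n
  proof -
    have "input_tape [m, n] = list_tape (replicate (Suc m) 1 @ 0 # replicate (Suc n) 1)"
      by (simp add: fun_eq_iff input_tape_def list_tape_def)
    from M[OF this] show ?thesis by simp
  qed
  then show ?thesis unfolding recursive2_def by blast
qed

lemma env_computable_recursive1:
  assumes "env_computable (\<lambda>e. f (e 0))"
  shows "recursive1 f"
proof -
  have "env_computable (\<lambda>e. f (e 0 - 1))"
    by (intro env_computable_lift1[OF assms] env_computable_diff env_computable_var env_computable_const)
  from env_computable_tm[OF this] obtain M where
    M: "\<And>ns m k. input_tape ns = list_tape (replicate m 1 @ 0 # replicate k 1) \<Longrightarrow>
      tm_computes M ns (f (m - 1))"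
    by auto
  have "tm_computes M [m] (f m)" for m
  proof -
    have "input_tape [m] = list_tape (replicate (Suc m) 1)"
      by (simp add: fun_eq_iff input_tape_def list_tape_def)
    also have "\<dots> = list_tape (replicate (Suc m) 1 @ 0 # replicate 0 1)"
      using list_tape_append_blank[of "replicate (Suc m) 1"] by simp
    finally show ?thesis using M by fastforce
  qed
  then show ?thesis unfolding recursive1_def by blast
qed

section \<open>Simulation of Turing machines\<close>

definition encodes :: "nat \<Rightarrow> nat \<Rightarrow> (nat \<Rightarrow> nat) \<Rightarrow> bool" where
  "encodes B X f \<longleftrightarrow> (\<forall>i. X div B ^ i mod B = f i)"

lemma encodes_0: "encodes B 0 (\<lambda>_. 0)"
  by (simp add: encodes_def)

lemma encodes_Cons:
  assumes "encodes B X f" "b < B"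
  shows "encodes B (b + B * X) (case_nat b f)"
  unfolding encodes_def
proof
  fix i
  show "(b + B * X) div B ^ i mod B = case_nat b f i"
  proof (cases i)
    case (Suc j)
    have "(b + B * X) div B ^ Suc j = (b + B * X) div B div B ^ j"
      by (simp add: div_mult2_eq)
    also have "(b + B * X) div B = X" using assms(2) by simp
    finally show ?thesis using assms(1) Suc by (simp add: encodes_def)
  qed (use assms(2) in simp)
qed

lemma encodes_tl:
  assumes "encodes B X f"
  shows "encodes B (X div B) (\<lambda>i. f (Suc i))"
  unfolding encodes_def
proof
  fix i
  show "X div B div B ^ i mod B = f (Suc i)"
    using assms[unfolded encodes_def, rule_format, of "Suc i"] by (simp add: div_mult2_eq)
qed

lemma encodes_hd: "encodes B X f \<Longrightarrow> X mod B = f 0"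
  using spec[of "\<lambda>i. X div B ^ i mod B = f i" 0] by (simp add: encodes_def)

lemma encodes_exists:
  assumes "\<And>i. f i < B" "\<And>i. i \<ge> K \<Longrightarrow> f i = 0"
  shows "\<exists>X. encodes B X f"
  using assms
proof (induction K arbitrary: f)
  case 0
  then have "f = (\<lambda>_. 0)" by auto
  then show ?case using encodes_0 by blast
next
  case (Suc K)
  then obtain X where "encodes B X (\<lambda>i. f (Suc i))"
    using Suc.IH[of "\<lambda>i. f (Suc i)"] Suc.prems Suc_le_mono by blast
  from encodes_Cons[OF this Suc.prems(1)[of 0]]
  have "encodes B (f 0 + B * X) (case_nat (f 0) (\<lambda>i. f (Suc i)))" .
  moreover have "case_nat (f 0) (\<lambda>i. f (Suc i)) = f" by (auto simp: fun_eq_iff split: nat.splits)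
  ultimately show ?case by auto
qed

definition count_ones :: "nat \<Rightarrow> nat \<Rightarrow> nat" where
  "count_ones B X = (\<Sum>i<X. of_bool (X div B ^ i mod B = 1))"

text \<open>A digit 1 at position i forces i < B^i \<le> X, so \<open>X\<close> itself bounds the
  sum in \<open>count_ones\<close>.\<close>

lemma encodes_one_bound:
  assumes "encodes B X f" "B \<ge> 2"
  shows "{i. f i = 1} \<subseteq> {..<X}"
proof
  fix i assume "i \<in> {i. f i = 1}"
  then have "X div B ^ i mod B = 1" using assms(1) by (simp add: encodes_def)
  then have "B ^ i \<le> X" by (cases "X < B ^ i") auto
  moreover have "i < B ^ i"
    using less_le_trans[OF less_exp power_mono[of 2 B i]] assms(2) by simp
  ultimately show "i \<in> {..<X}" by simp
qed

lemma count_ones_eq: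
  assumes "encodes B X f" "B \<ge> 2"
  shows "count_ones B X = card {i. f i = 1}"
proof -
  have "{..<X} \<inter> {i. f i = 1} = {i. f i = 1}" using encodes_one_bound[OF assms] by auto
  moreover have "count_ones B X = card ({..<X} \<inter> {i. f i = 1})"
    using assms(1) by (simp add: count_ones_def encodes_def)
  ultimately show ?thesis by simp
qed

abbreviation pfst :: "nat \<Rightarrow> nat" where "pfst n \<equiv> fst (prod_decode n)"
abbreviation psnd :: "nat \<Rightarrow> nat" where "psnd n \<equiv> snd (prod_decode n)"
abbreviation pair :: "nat \<Rightarrow> nat \<Rightarrow> nat" where "pair a b \<equiv> prod_encode (a, b)"

text \<open>
  A machine is coded by \<open>pair B (pair D N)\<close>: B exceeds all written symbols, and the base-D digit of
  N at position q * B + a is 0 if (q, a) has no entry and the successor of the coded entry otherwise.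
  A configuration is coded by \<open>pair q (pair L R)\<close>, where the base-B digits of L and R are the cells to
  the left of the head (read leftwards) and those from the head on.
\<close>

definition sim_entry :: "nat \<Rightarrow> nat \<Rightarrow> nat" where
  "sim_entry m c = psnd (psnd m) div pfst (psnd m) ^ (pfst c * pfst m + psnd (psnd c) mod pfst m)
     mod pfst (psnd m)"

definition sim_move :: "nat \<Rightarrow> nat \<Rightarrow> nat \<Rightarrow> nat" where
  "sim_move B x t =
    (if psnd x = 0 then pair (pfst t div B) (pfst t mod B + B * (pfst x + B * (psnd t div B)))
     else if psnd x = 1 then pair (pfst t) (pfst x + B * (psnd t div B))
     else pair (pfst x + B * pfst t) (psnd t div B))"

text \<open>Configurations without applicable entry are made fixed points, so that halting persists
  in time.\<close>

definition sim_step :: "nat \<Rightarrow> nat \<Rightarrow> nat" where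
  "sim_step m c = (if sim_entry m c = 0 then c
     else pair (pfst (sim_entry m c - 1)) (sim_move (pfst m) (psnd (sim_entry m c - 1)) (psnd c)))"

text \<open>The start value \<open>B\<close> has the digits 0, 1: the separating blank and the
  single stroke of the second argument 0. Each round prepends a stroke of the first
  argument.\<close>

definition sim_input :: "nat \<Rightarrow> nat \<Rightarrow> nat" where
  "sim_input B n = rec_nat B (\<lambda>_ X. 1 + B * X) (Suc n)"

definition sim_config :: "nat \<Rightarrow> nat \<Rightarrow> nat \<Rightarrow> nat" where
  "sim_config m n T = rec_nat (pair 0 (pair 0 (sim_input (pfst m) n))) (\<lambda>_ c. sim_step m c) T"

definition sim_halted :: "nat \<Rightarrow> nat \<Rightarrow> nat \<Rightarrow> bool" where
  "sim_halted m n T \<longleftrightarrow> sim_entry m (sim_config m n T) = 0"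

definition sim_output :: "nat \<Rightarrow> nat \<Rightarrow> nat \<Rightarrow> nat" where
  "sim_output m n T = count_ones (pfst m) (pfst (psnd (sim_config m n T)))
     + count_ones (pfst m) (psnd (psnd (sim_config m n T)))"

lemmas env_computable_intros = env_computable_var env_computable_const env_computable_Suc
  env_computable_add env_computable_mult env_computable_power env_computable_diff env_computable_if
  env_computable_less env_computable_not env_computable_and env_computable_eq env_computable_sum
  env_computable_div env_computable_mod env_computable_prod_encode env_computable_prod_decode

lemma env_computable_count_ones:
  assumes "env_computable F" "env_computable G"
  shows "env_computable (\<lambda>e. count_ones (F e) (G e))"
  by (rule env_computable_lift2[OF _ assms], unfold count_ones_def) (intro env_computable_intros)

lemma env_computable_sim_entry:
  assumes "env_computable F" "env_computable G"
  shows "env_computable (\<lambda>e. sim_entry (F e) (G e))"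
  by (rule env_computable_lift2[OF _ assms], unfold sim_entry_def) (intro env_computable_intros)

lemma env_computable_sim_move:
  assumes "env_computable F" "env_computable G" "env_computable H"
  shows "env_computable (\<lambda>e. sim_move (F e) (G e) (H e))"
  by (rule env_computable_lift3[OF _ assms], unfold sim_move_def) (intro env_computable_intros)

lemma env_computable_sim_step:
  assumes "env_computable F" "env_computable G"
  shows "env_computable (\<lambda>e. sim_step (F e) (G e))"
  by (rule env_computable_lift2[OF _ assms], unfold sim_step_def)
    (intro env_computable_intros env_computable_sim_entry env_computable_sim_move)

lemma env_computable_sim_input:
  assumes "env_computable F" "env_computable G"
  shows "env_computable (\<lambda>e. sim_input (F e) (G e))"
  by (rule env_computable_lift2[OF _ assms], unfold sim_input_def)
    (intro env_computable_rec_nat env_computable_intros)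

lemma env_computable_sim_config:
  assumes "env_computable F" "env_computable G" "env_computable H"
  shows "env_computable (\<lambda>e. sim_config (F e) (G e) (H e))"
  by (rule env_computable_lift3[OF _ assms], unfold sim_config_def)
    (intro env_computable_rec_nat env_computable_sim_step env_computable_sim_input env_computable_intros)

lemma env_computable_sim_halted:
  assumes "env_computable F" "env_computable G" "env_computable H"
  shows "env_computable (\<lambda>e. of_bool (sim_halted (F e) (G e) (H e)))"
  unfolding sim_halted_def
  by (intro env_computable_eq env_computable_sim_entry env_computable_sim_config env_computable_const assms)

lemma env_computable_sim_output:
  assumes "env_computable F" "env_computable G" "env_computable H"
  shows "env_computable (\<lambda>e. sim_output (F e) (G e) (H e))"
  unfolding sim_output_def
  by (intro env_computable_add env_computable_count_ones env_computable_sim_config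
    env_computable_prod_decode assms)

lemma sim_halted_stable:
  assumes "sim_halted m n j" "j \<le> T"
  shows "sim_config m n T = sim_config m n j"
  using assms(2)
proof (induction T rule: dec_induct)
  case (step T)
  then have "sim_config m n (Suc T) = sim_step m (sim_config m n j)" by (simp add: sim_config_def)
  then show ?case using assms(1) by (simp add: sim_step_def sim_halted_def)
qed simp

section \<open>Codes of machines and correctness of the simulation\<close>

fun move_code :: "move \<Rightarrow> nat" where
  "move_code Move_Left = 0"
| "move_code Stay = 1"
| "move_code Move_Right = 2"

definition entry_code :: "(nat \<times> nat \<times> move) option \<Rightarrow> nat" where
  "entry_code x = (case x of None \<Rightarrow> 0 | Some (q, b, d) \<Rightarrow> Suc (pair q (pair b (move_code d))))"

definition codes_tm :: "nat \<Rightarrow> tm \<Rightarrow> bool" where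
  "codes_tm m M \<longleftrightarrow> 2 \<le> pfst m \<and>
     (\<forall>k q b d. map_of M k = Some (q, b, d) \<longrightarrow> b < pfst m) \<and>
     (\<forall>q a. a < pfst m \<longrightarrow>
        psnd (psnd m) div pfst (psnd m) ^ (q * pfst m + a) mod pfst (psnd m) = entry_code (map_of M (q, a)))"

text \<open>A program has finitely many entries, so its table is an eventually vanishing sequence of
  bounded digits and packs into one number.\<close>

lemma codes_tm_exists: "\<exists>m. codes_tm m M"
proof -
  have "finite ((\<lambda>(q, b, d). b) ` ran (map_of M))"
    by (intro finite_imageI finite_ran finite_dom_map_of)
  then obtain B0 where B0: "\<And>b. b \<in> (\<lambda>(q, b, d). b) ` ran (map_of M) \<Longrightarrow> b < B0"
    unfolding finite_nat_set_iff_bounded by blast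
  define B where "B = B0 + 2"
  have wB: "b < B" if "map_of M k = Some (q, b, d)" for k q b d
    using B0[of b] ranI[of "map_of M" k, OF that] by (force simp: B_def)
  define g where "g = (\<lambda>i. entry_code (map_of M (i div B, i mod B)))"
  have fin: "finite {i. g i \<noteq> 0}"
  proof (rule finite_subset)
    show "{i. g i \<noteq> 0} \<subseteq> (\<lambda>(q, a). q * B + a) ` dom (map_of M)"
    proof
      fix i assume "i \<in> {i. g i \<noteq> 0}"
      then have "(i div B, i mod B) \<in> dom (map_of M)"
        by (auto simp: g_def entry_code_def split: option.splits)
      then show "i \<in> (\<lambda>(q, a). q * B + a) ` dom (map_of M)"
        by (rule rev_image_eqI) simp
    qed
  qed (simp add: finite_dom_map_of)
  then obtain K where K: "\<And>i. i \<ge> K \<Longrightarrow> g i = 0"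
    unfolding finite_nat_set_iff_bounded by (metis (mono_tags) mem_Collect_eq not_less)
  have "finite (insert 0 (g ` {i. g i \<noteq> 0}))" using fin by blast
  then obtain D where D: "\<And>i. g i < D"
    unfolding finite_nat_set_iff_bounded by (metis (mono_tags) imageI insertCI mem_Collect_eq)
  obtain N where N: "encodes D N g" using encodes_exists[of g D K] D K by blast
  define m where "m = pair B (pair D N)"
  have "codes_tm m M"
    unfolding codes_tm_def
  proof (intro conjI allI impI)
    show "2 \<le> pfst m" by (simp add: m_def B_def)
    show "b < pfst m" if "map_of M k = Some (q, b, d)" for k q b d
      using wB[OF that] by (simp add: m_def)
    fix q a assume "a < pfst m"
    then show "psnd (psnd m) div pfst (psnd m) ^ (q * pfst m + a) mod pfst (psnd m) = entry_code (map_of M (q, a))"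
      using N by (simp add: m_def encodes_def g_def)
  qed
  then show ?thesis by blast
qed

definition codes_config :: "nat \<Rightarrow> nat \<Rightarrow> config \<Rightarrow> bool" where
  "codes_config B c = (\<lambda>(q, h, t). pfst c = q \<and>
     encodes B (pfst (psnd c)) (\<lambda>i. t (h - 1 - int i)) \<and> encodes B (psnd (psnd c)) (\<lambda>i. t (h + int i)))"

lemma sim_entry_correct:
  assumes "codes_tm m M" "codes_config (pfst m) c (q, h, t)"
  shows "sim_entry m c = entry_code (map_of M (q, t h))"
proof -
  have "psnd (psnd c) mod pfst m = t h"
    using encodes_hd assms(2) by (fastforce simp: codes_config_def)
  moreover have "psnd (psnd c) mod pfst m < pfst m" using assms(1) by (simp add: codes_tm_def)
  ultimately show ?thesis using assms by (simp add: sim_entry_def codes_tm_def codes_config_def)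
qed

lemma sim_step_correct:
  assumes m: "codes_tm m M" and c: "codes_config (pfst m) c (q, h, t)"
    and step: "tm_step M (q, h, t) cfg"
  shows "codes_config (pfst m) (sim_step m c) cfg"
proof -
  obtain q' b d where M: "map_of M (q, t h) = Some (q', b, d)" and cfg: "cfg = (q', move_head d h, t(h := b))"
    using step by (auto elim: tm_step.cases)
  define B where "B = pfst m"
  define L where "L = pfst (psnd c)"
  define R where "R = psnd (psnd c)"
  have bB: "b < B" using m M unfolding codes_tm_def B_def by blast
  have B2: "0 < B" using m by (simp add: codes_tm_def B_def)
  have LR: "encodes B L (\<lambda>i. t (h - 1 - int i))" "encodes B R (\<lambda>i. t (h + int i))"
    using c by (simp_all add: codes_config_def B_def L_def R_def)
  have R1: "encodes B (R div B) (\<lambda>i. t (h + 1 + int i))"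
    using encodes_tl[OF LR(2)] by (simp add: add.assoc)
  have W: "encodes B (b + B * (R div B)) (case_nat b (\<lambda>i. t (h + 1 + int i)))"
    by (rule encodes_Cons[OF R1 bB])
  have s: "sim_step m c = pair q' (sim_move B (pair b (move_code d)) (psnd c))"
    using sim_entry_correct[OF m c] M by (simp add: sim_step_def entry_code_def B_def)
  show ?thesis
  proof (cases d)
    case Move_Left
    have 1: "encodes B (L div B) (\<lambda>i. t (h - 2 - int i))"
      using encodes_tl[OF LR(1)] by (simp add: algebra_simps)
    have 2: "encodes B (L mod B + B * (b + B * (R div B)))
      (case_nat (L mod B) (case_nat b (\<lambda>i. t (h + 1 + int i))))"
      by (rule encodes_Cons[OF W]) (use B2 in simp)
    have "L mod B = t (h - 1)" using encodes_hd[OF LR(1)] by simp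
    then have "case_nat (L mod B) (case_nat b (\<lambda>i. t (h + 1 + int i))) = (\<lambda>i. (t(h := b)) (h - 1 + int i))"
      by (auto simp: fun_eq_iff algebra_simps split: nat.splits)
    moreover have "(\<lambda>i. t (h - 2 - int i)) = (\<lambda>i. (t(h := b)) (h - 1 - 1 - int i))"
      by (auto simp: fun_eq_iff)
    ultimately show ?thesis
      using 1 2 by (simp add: s cfg Move_Left codes_config_def sim_move_def B_def[symmetric] L_def[symmetric] R_def[symmetric])
  next
    case Stay
    have "case_nat b (\<lambda>i. t (h + 1 + int i)) = (\<lambda>i. (t(h := b)) (h + int i))"
      by (auto simp: fun_eq_iff algebra_simps split: nat.splits)
    moreover have "(\<lambda>i. t (h - 1 - int i)) = (\<lambda>i. (t(h := b)) (h - 1 - int i))"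
      by (auto simp: fun_eq_iff)
    ultimately show ?thesis
      using LR(1) W by (simp add: s cfg Stay codes_config_def sim_move_def B_def[symmetric] L_def[symmetric] R_def[symmetric])
  next
    case Move_Right
    have 1: "encodes B (b + B * L) (case_nat b (\<lambda>i. t (h - 1 - int i)))"
      by (rule encodes_Cons[OF LR(1) bB])
    have "case_nat b (\<lambda>i. t (h - 1 - int i)) = (\<lambda>i. (t(h := b)) (h + 1 - 1 - int i))"
      by (auto simp: fun_eq_iff algebra_simps split: nat.splits)
    moreover have "(\<lambda>i. t (h + 1 + int i)) = (\<lambda>i. (t(h := b)) (h + 1 + int i))"
      by (auto simp: fun_eq_iff)
    ultimately show ?thesis
      using 1 R1 by (simp add: s cfg Move_Right codes_config_def sim_move_def B_def[symmetric] L_def[symmetric] R_def[symmetric])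
  qed
qed

lemma encodes_sim_input:
  assumes "B \<ge> 2"
  shows "encodes B (sim_input B n) (\<lambda>i. input_tape [n, 0] (int i))"
proof -
  \<comment> \<open>After \<open>k\<close> rounds digit \<open>k\<close> is the blank and digit
    \<open>Suc k\<close> the stroke of the second argument.\<close>
  have "encodes B (rec_nat B (\<lambda>_ X. 1 + B * X) k) (\<lambda>i. if i < k \<or> i = Suc k then 1 else 0)" for k
  proof (induction k)
    case 0
    have "encodes B (0 + B * (1 + B * 0)) (case_nat 0 (case_nat 1 (\<lambda>_. 0)))"
      using assms by (intro encodes_Cons encodes_0) auto
    moreover have "case_nat 0 (case_nat 1 (\<lambda>_. 0)) = (\<lambda>i. if i < 0 \<or> i = Suc 0 then 1 else 0 :: nat)"
      by (auto simp: fun_eq_iff split: nat.splits)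
    ultimately show ?case by simp
  next
    case (Suc k)
    have "1 < B" using assms by simp
    from encodes_Cons[OF Suc this]
    have "encodes B (1 + B * rec_nat B (\<lambda>_ X. 1 + B * X) k) (case_nat 1 (\<lambda>i. if i < k \<or> i = Suc k then 1 else 0))" .
    moreover have "case_nat 1 (\<lambda>i. if i < k \<or> i = Suc k then 1 else 0) =
        (\<lambda>i. if i < Suc k \<or> i = Suc (Suc k) then 1 else 0 :: nat)"
      by (auto simp: fun_eq_iff split: nat.splits)
    ultimately show ?case by simp
  qed
  then have "encodes B (sim_input B n) (\<lambda>i. if i < Suc n \<or> i = Suc (Suc n) then 1 else 0)"
    unfolding sim_input_def .
  moreover have "(if i < Suc n \<or> i = Suc (Suc n) then 1 else 0) = input_tape [n, 0] (int i)" for i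
  proof -
    have "unary_word [n, 0] = replicate (Suc n) 1 @ [0, 1]" by simp
    then have "input_tape [n, 0] (int i) =
      (if i < n + 3 then (replicate (Suc n) 1 @ [0, 1]) ! i else 0)"
      by (simp only: input_tape_def) simp
    moreover consider "i < Suc n" | "i = Suc n" | "i = Suc (Suc n)" | "i > Suc (Suc n)" by linarith
    ultimately show ?thesis by cases (simp_all add: nth_append del: replicate_Suc)
  qed
  ultimately show ?thesis by (simp only: encodes_def simp_thms)
qed

lemma card_tape_split:
  fixes t :: "int \<Rightarrow> nat"
  assumes "finite {i :: nat. t (h - 1 - int i) = 1}" "finite {i :: nat. t (h + int i) = 1}"
  shows "card {i. t i = 1} = card {i. t (h - 1 - int i) = 1} + card {i. t (h + int i) = 1}"
proof -
  let ?L = "(\<lambda>i. h - 1 - int i) ` {i. t (h - 1 - int i) = 1}"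
  let ?R = "(\<lambda>i. h + int i) ` {i. t (h + int i) = 1}"
  have "{i. t i = 1} = ?L \<union> ?R"
  proof (intro equalityI subsetI)
    fix i assume i: "i \<in> {i. t i = 1}"
    show "i \<in> ?L \<union> ?R"
    proof (cases "h \<le> i")
      case True
      then have "i = h + int (nat (i - h))" by simp
      then show ?thesis using i by (metis (mono_tags, lifting) UnI2 image_eqI mem_Collect_eq)
    next
      case False
      then have "i = h - 1 - int (nat (h - 1 - i))" by simp
      then show ?thesis using i by (metis (mono_tags, lifting) UnI1 image_eqI mem_Collect_eq)
    qed
  qed auto
  moreover have "card (?L \<union> ?R) = card ?L + card ?R"
    using assms by (intro card_Un_disjoint) auto
  moreover have "card ?L = card {i. t (h - 1 - int i) = 1}" "card ?R = card {i. t (h + int i) = 1}"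
    by (auto intro!: card_image simp: inj_on_def)
  ultimately show ?thesis by simp
qed

text \<open>Holding from some time on, and not just at the halting time, lets three machines be read
  at one common time.\<close>

lemma sim_correct:
  assumes m: "codes_tm m M" and M: "tm_computes M [n, 0] v"
  shows "\<exists>j. \<forall>T\<ge>j. sim_halted m n T \<and> sim_output m n T = v"
proof -
  obtain q h t where run: "(tm_step M)\<^sup>*\<^sup>* (0, 0, input_tape [n, 0]) (q, h, t)"
    and halt: "tm_halted M (q, h, t)" and v: "card {i. t i = 1} = v"
    using M unfolding tm_computes_def by blast
  have B2: "2 \<le> pfst m" using m by (simp add: codes_tm_def)
  have "\<exists>j. codes_config (pfst m) (sim_config m n j) (q, h, t)"
    using run
  proof (induction "(q, h, t)" arbitrary: q h t rule: rtranclp_induct)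
    case base
    have "(\<lambda>i. input_tape [n, 0] (- 1 - int i)) = (\<lambda>_. 0)" by (auto simp: input_tape_def)
    then have "codes_config (pfst m) (sim_config m n 0) (0, 0, input_tape [n, 0])"
      using encodes_0[of "pfst m"] encodes_sim_input[OF B2, of n]
      by (simp add: codes_config_def sim_config_def)
    then show ?case by blast
  next
    case (step y)
    obtain q0 h0 t0 where y: "y = (q0, h0, t0)" by (cases y) auto
    then obtain j where j: "codes_config (pfst m) (sim_config m n j) (q0, h0, t0)" using step by blast
    have "codes_config (pfst m) (sim_config m n (Suc j)) (q, h, t)"
      using sim_step_correct[OF m j] step.hyps(2) y by (simp add: sim_config_def)
    then show ?case by blast
  qed
  then obtain j where j: "codes_config (pfst m) (sim_config m n j) (q, h, t)" by blast
  have halted: "sim_halted m n j"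
    using sim_entry_correct[OF m j] halt by (simp add: sim_halted_def entry_code_def tm_halted_def)
  have L: "encodes (pfst m) (pfst (psnd (sim_config m n j))) (\<lambda>i. t (h - 1 - int i))"
    and R: "encodes (pfst m) (psnd (psnd (sim_config m n j))) (\<lambda>i. t (h + int i))"
    using j by (simp_all add: codes_config_def)
  have "sim_output m n j = v"
    unfolding sim_output_def count_ones_eq[OF L B2] count_ones_eq[OF R B2] v[symmetric]
    by (rule card_tape_split[symmetric]) (rule finite_subset[OF encodes_one_bound[OF L B2]] finite_subset[OF encodes_one_bound[OF R B2]], simp)+
  then have "sim_halted m n T \<and> sim_output m n T = v" if "T \<ge> j" for T
    using halted sim_halted_stable[OF halted that] by (simp add: sim_halted_def sim_output_def)
  then show ?thesis by blast
qed

section \<open>A diagonal sequence\<close>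

text \<open>
  The argument n is itself read as three machine codes, for the sign, numerator and denominator of
  an approximation to within 1; the approximation is assigned the parity of s + p div (30 q), which
  classifies real numbers x near 20 or -40 (even) and near -20 or 40 (odd). Once the machines have
  halted on input (n, 0) at time T, the value of the diagonal sequence is
  \<open>\<plusminus>1 / 2 ^ (T + 3)\<close>, with the sign opposite to the claimed one.
\<close>

definition diag_halted :: "nat \<Rightarrow> nat \<Rightarrow> bool" where
  "diag_halted n T \<longleftrightarrow> sim_halted (pfst n) n T \<and> sim_halted (pfst (psnd n)) n T \<and>
     sim_halted (psnd (psnd n)) n T"

definition diag_bit :: "nat \<Rightarrow> nat \<Rightarrow> nat" where
  "diag_bit n T = (sim_output (pfst n) n T +
     sim_output (pfst (psnd n)) n T div (30 * sim_output (psnd (psnd n)) n T)) mod 2"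

text \<open>As halting persists, the sum is the minimum of \<open>T\<close> and the first halting
  time: a bounded sum takes the place of the search in \<open>diag_real\<close>.\<close>

definition diag_weight :: "nat \<Rightarrow> nat \<Rightarrow> nat" where
  "diag_weight n T = 2 ^ ((\<Sum>j<T. of_bool (\<not> diag_halted n j)) + 3)"

definition diag_real :: "nat \<Rightarrow> real" where
  "diag_real n = (if \<exists>T. diag_halted n T then
     let T = LEAST T. diag_halted n T in (if diag_bit n T = 0 then - 1 else 1) / 2 ^ (T + 3) else 0)"

lemma env_computable_diag_bit:
  assumes "env_computable F" "env_computable G"
  shows "env_computable (\<lambda>e. diag_bit (F e) (G e))"
  unfolding diag_bit_def
  by (intro env_computable_mod env_computable_add env_computable_div env_computable_mult
    env_computable_const env_computable_sim_output env_computable_prod_decode assms)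

lemma env_computable_diag_weight:
  assumes "env_computable F" "env_computable G"
  shows "env_computable (\<lambda>e. diag_weight (F e) (G e))"
  by (rule env_computable_lift2[OF _ assms], unfold diag_weight_def diag_halted_def)
    (intro env_computable_power env_computable_add env_computable_sum env_computable_not
      env_computable_and env_computable_sim_halted env_computable_prod_decode
      env_computable_const env_computable_var)

lemma diag_halted_stable:
  assumes "diag_halted n j" "j \<le> T"
  shows "diag_halted n T" "diag_bit n T = diag_bit n j"
  using assms sim_halted_stable[of _ n j T]
  by (auto simp: diag_halted_def diag_bit_def sim_halted_def sim_output_def)

text \<open>Either halting has occurred by time \<open>k\<close> and the approximation is exact, or
  it comes later, if at all, and the true value is at most as large as the approximation.\<close>

lemma diag_real_approx:
  "diag_real n = (if diag_bit n k = 0 then - 1 else 1) / real (diag_weight n k) \<or>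
   \<bar>diag_real n\<bar> \<le> 1 / 2 ^ (k + 3) \<and> diag_weight n k = 2 ^ (k + 3)"
proof (cases "\<exists>T\<le>k. diag_halted n T")
  case True
  then obtain T1 where T1: "T1 \<le> k" "diag_halted n T1" by blast
  define T where "T = (LEAST T. diag_halted n T)"
  have T: "diag_halted n T" "T \<le> k"
    using LeastI[of "diag_halted n", OF T1(2)] Least_le[of "diag_halted n", OF T1(2)] T1(1)
    by (simp_all add: T_def)
  have "\<not> diag_halted n j \<longleftrightarrow> j < T" for j
    using not_less_Least[of j "diag_halted n"] diag_halted_stable(1)[OF T(1), of j]
    unfolding T_def[symmetric] by (meson not_less)
  then have "(\<Sum>j<k. of_bool (\<not> diag_halted n j)) = (\<Sum>j<k. of_bool (j < T) :: nat)" by simp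
  also have "\<dots> = card ({..<k} \<inter> {j. j < T})" by simp
  also have "{..<k} \<inter> {j. j < T} = {..<T}" using T(2) by auto
  finally have "diag_weight n k = 2 ^ (T + 3)" by (simp add: diag_weight_def)
  moreover have "diag_real n = (if diag_bit n k = 0 then - 1 else 1) / 2 ^ (T + 3)"
    using T1(2) diag_halted_stable(2)[OF T] by (auto simp: diag_real_def Let_def T_def)
  ultimately show ?thesis by simp
next
  case False
  then have "(\<Sum>j<k. of_bool (\<not> diag_halted n j)) = (\<Sum>j<k. 1 :: nat)"
    by (intro sum.cong) auto
  then have w: "diag_weight n k = 2 ^ (k + 3)" by (simp add: diag_weight_def)
  have "\<bar>diag_real n\<bar> \<le> 1 / 2 ^ (k + 3)"
  proof (cases "\<exists>T. diag_halted n T")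
    case True
    define T where "T = (LEAST T. diag_halted n T)"
    have "diag_halted n T" using True LeastI_ex[of "diag_halted n"] by (simp add: T_def)
    then have "k \<le> T" using False by (meson nat_le_linear)
    then have "1 / 2 ^ (T + 3) \<le> (1 / 2 ^ (k + 3) :: real)"
      by (intro divide_left_mono power_increasing) auto
    moreover have "\<bar>diag_real n\<bar> = 1 / 2 ^ (T + 3)"
      using True by (simp add: diag_real_def T_def Let_def)
    ultimately show ?thesis by simp
  qed (simp add: diag_real_def)
  with w show ?thesis by simp
qed

text \<open>Take for \<open>n\<close> the code of the very machines that compute \<open>s\<close>,
  \<open>p\<close> and \<open>q\<close>. The second argument 0 selects the approximation to within
  1.\<close>

lemma diag_real_defeats:
  assumes "recursive2 s" "recursive2 p" "recursive2 q"
  shows "\<exists>n. diag_real n \<noteq> 0 \<and>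
    (diag_real n > 0 \<longleftrightarrow> odd (s n 0 + p n 0 div (30 * q n 0)))"
proof -
  obtain M1 M2 M3 where M: "\<And>n. tm_computes M1 [n, 0] (s n 0)" "\<And>n. tm_computes M2 [n, 0] (p n 0)"
    "\<And>n. tm_computes M3 [n, 0] (q n 0)"
    using assms unfolding recursive2_def by meson
  obtain m1 m2 m3 where m: "codes_tm m1 M1" "codes_tm m2 M2" "codes_tm m3 M3"
    using codes_tm_exists by meson
  define n where "n = pair m1 (pair m2 m3)"
  obtain j1 j2 j3 where j:
    "\<And>T. T \<ge> j1 \<Longrightarrow> sim_halted m1 n T \<and> sim_output m1 n T = s n 0"
    "\<And>T. T \<ge> j2 \<Longrightarrow> sim_halted m2 n T \<and> sim_output m2 n T = p n 0"
    "\<And>T. T \<ge> j3 \<Longrightarrow> sim_halted m3 n T \<and> sim_output m3 n T = q n 0"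
    using sim_correct[OF m(1) M(1)] sim_correct[OF m(2) M(2)] sim_correct[OF m(3) M(3)] by meson
  define k where "k = max j1 (max j2 j3)"
  have k: "diag_halted n k" "diag_bit n k = (s n 0 + p n 0 div (30 * q n 0)) mod 2"
    using j(1)[of k] j(2)[of k] j(3)[of k] by (auto simp: diag_halted_def diag_bit_def n_def k_def)
  define X where "X = s n 0 + p n 0 div (30 * q n 0)"
  define T where "T = (LEAST T. diag_halted n T)"
  have "diag_halted n T" "T \<le> k"
    using LeastI[of "diag_halted n", OF k(1)] Least_le[of "diag_halted n", OF k(1)] by (simp_all add: T_def)
  then have "diag_real n = (if diag_bit n k = 0 then - 1 else 1) / 2 ^ (T + 3)"
    using k(1) diag_halted_stable(2)[of n T k] by (auto simp: diag_real_def Let_def T_def)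
  then have e: "diag_real n = (if X mod 2 = 0 then - 1 else 1) / 2 ^ (T + 3)"
    by (simp only: k(2) X_def)
  have "diag_real n \<noteq> 0 \<and> (diag_real n > 0 \<longleftrightarrow> odd X)"
    unfolding e by (cases "even X") (simp_all add: even_iff_mod_2_eq_zero)
  then show ?thesis unfolding X_def by blast
qed

section \<open>Computable reals built from the diagonal sequence\<close>

lemma env_computable_real_seq:
  assumes "env_computable (\<lambda>e. P (e 0) (e 1))" "env_computable (\<lambda>e. Q (e 0) (e 1))"
    and "\<And>n k. Q n k \<noteq> 0"
    and "\<And>n k. \<bar>(- 1) ^ s * (real (P n k) / real (Q n k)) - x n\<bar> \<le> 1 / 2 ^ k"
  shows "computable_real_seq x" "computable_real (x n)"
proof -
  let ?r = "\<lambda>n k. (- 1) ^ s * (of_nat (P n k) / of_nat (Q n k)) :: rat"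
  have r: "real_of_rat (?r n k) = (- 1) ^ s * (real (P n k) / real (Q n k))" for n k
    by (simp add: of_rat_mult of_rat_divide of_rat_power of_rat_minus)
  have "computable_rat_double_seq ?r"
    unfolding computable_rat_double_seq_def
    by (intro exI[of _ "\<lambda>_ _. s"] exI[of _ P] exI[of _ Q] conjI allI refl assms(3)
      env_computable_recursive2 env_computable_const assms(1,2))
  then show "computable_real_seq x"
    unfolding computable_real_seq_def using assms(4) r by (intro exI[of _ ?r]) simp
  have "computable_rat_seq (?r n)"
    unfolding computable_rat_seq_def
    by (intro exI[of _ "\<lambda>_. s"] exI[of _ "P n"] exI[of _ "Q n"] conjI allI refl assms(3)
      env_computable_recursive1 env_computable_const env_computable_lift2[OF assms(1)]
      env_computable_lift2[OF assms(2)] env_computable_var)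
  then show "computable_real (x n)"
    unfolding computable_real_def using assms(4) r by (intro exI[of _ "?r n"]) simp
qed

text \<open>The common shape of the target values and of the entries of
  \<open>fitting_matrix\<close>. Splitting e into positive and negative part keeps the coefficients
  natural and the overall sign independent of n.\<close>

definition diag_combination :: "nat \<Rightarrow> nat \<Rightarrow> nat \<Rightarrow> nat \<Rightarrow> nat \<Rightarrow> real" where
  "diag_combination s c a b n =
     (- 1) ^ s * (real c + real a * relu (diag_real n) + real b * relu (- diag_real n))"

lemma computable_diag_combination:
  assumes "a \<le> 2" "b \<le> 2"
  shows "computable_real_seq (diag_combination s c a b)" "computable_real (diag_combination s c a b n)"
proof -
  let ?P = "\<lambda>n k. c * diag_weight n k + (if diag_bit n k = 0 then b else a)"
  let ?Q = "diag_weight"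
  have W: "real (diag_weight n k) > 0" for n k by (simp add: diag_weight_def)
  have bound: "\<bar>(- 1) ^ s * (real (?P n k) / real (?Q n k)) - diag_combination s c a b n\<bar> \<le> 1 / 2 ^ k" for n k
  proof -
    define e where "e = diag_real n"
    define w where "w = 1 / real (diag_weight n k)"
    define g where "g = real (if diag_bit n k = 0 then b else a)"
    have w0: "w > 0" using W by (simp add: w_def)
    have "real (?P n k) / real (?Q n k) = real c + g * w"
      using W[of n k] by (simp add: g_def w_def field_simps)
    then have "\<bar>(- 1) ^ s * (real (?P n k) / real (?Q n k)) - diag_combination s c a b n\<bar>
        = \<bar>(- 1) ^ s * (g * w - (real a * relu e + real b * relu (- e)))\<bar>"
      by (simp add: diag_combination_def e_def algebra_simps)
    also have "\<dots> = \<bar>g * w - (real a * relu e + real b * relu (- e))\<bar>"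
      by (simp add: abs_mult power_abs)
    also have "\<dots> \<le> 1 / 2 ^ k"
      using diag_real_approx[of n k]
    proof
      assume "diag_real n = (if diag_bit n k = 0 then - 1 else 1) / real (diag_weight n k)"
      then have "e = (if diag_bit n k = 0 then - w else w)" by (simp add: e_def w_def)
      then show ?thesis using w0 by (auto simp: relu_def g_def)
    next
      assume *: "\<bar>diag_real n\<bar> \<le> 1 / 2 ^ (k + 3) \<and> diag_weight n k = 2 ^ (k + 3)"
      have g: "0 \<le> g" "g \<le> 2" using assms by (auto simp: g_def)
      have "g * w \<le> 2 * w" using g w0 by simp
      moreover have "0 \<le> g * w" using g w0 by simp
      moreover have "0 \<le> real a * relu e" "real a * relu e \<le> 2 * relu e"
          "0 \<le> real b * relu (- e)" "real b * relu (- e) \<le> 2 * relu (- e)"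
        using assms by (auto simp: relu_def intro!: mult_right_mono)
      moreover have "relu e + relu (- e) = \<bar>e\<bar>" by (simp add: relu_def)
      moreover have "\<bar>e\<bar> \<le> w" using * by (simp add: e_def w_def)
      \<comment> \<open>This is what the 3 in the exponent of the weight is for: coefficients up to
        2 bound both compared terms by \<open>2 * w\<close>.\<close>
      moreover have "4 * w \<le> 1 / 2 ^ k" using * by (simp add: w_def power_add field_simps)
      ultimately show ?thesis by linarith
    qed
    finally show ?thesis .
  qed
  have P: "env_computable (\<lambda>e. ?P (e 0) (e 1))"
    by (intro env_computable_add env_computable_mult env_computable_if env_computable_eq
      env_computable_diag_bit env_computable_diag_weight env_computable_const env_computable_var)
  have Q: "env_computable (\<lambda>e. ?Q (e 0) (e 1))"
    by (intro env_computable_diag_weight env_computable_var)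
  have "?Q n k \<noteq> 0" for n k by (simp add: diag_weight_def)
  from env_computable_real_seq[OF P Q this bound]
  show "computable_real_seq (diag_combination s c a b)" "computable_real (diag_combination s c a b n)" .
qed

lemma computable_of_int:
  "computable_real_seq (\<lambda>_. real_of_int z)" "computable_real (real_of_int z)"
proof -
  have "(\<lambda>_. real_of_int z) = diag_combination (if z < 0 then 1 else 0) (nat \<bar>z\<bar>) 0 0"
    by (auto simp: fun_eq_iff diag_combination_def)
  then show "computable_real_seq (\<lambda>_. real_of_int z)" "computable_real (real_of_int z)"
    using computable_diag_combination[of 0 0] by (metis zero_le)+
qed

section \<open>Uniqueness of exact fits\<close>

lemma relu_add_eq_iff:
  "relu (u + v) = relu u + relu v \<longleftrightarrow> (u \<ge> 0 \<and> v \<ge> 0) \<or> (u \<le> 0 \<and> v \<le> 0)"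
  by (auto simp: relu_def max_def)

lemma relu_add_le: "relu (u + v) \<le> relu u + relu v"
  by (simp add: relu_def)

lemma relu_mult_left: "c \<ge> 0 \<Longrightarrow> relu (c * x) = c * relu x"
  by (simp add: relu_def max_mult_distrib_left)

lemma relu_uminus: "relu (- x) = relu x - x"
  by (simp add: relu_def)

text \<open>
  Additivity on the cones spanned by (1,0), (0,1), by (-1,1), (0,1) and by (-1,1), (-1,0) forces the
  kink of each neuron onto one of the lines s = 0, t = 0, s + t = 0.
\<close>

lemma relu_rows_on_lines:
  fixes a1 a2 a3 b1 b2 b3 :: real
  defines "N \<equiv> \<lambda>s t. relu (a1 * s + b1 * t) + relu (a2 * s + b2 * t) + relu (a3 * s + b3 * t)"
  assumes "N 1 1 = N 1 0 + N 0 1" "N (- 1) 2 = N (- 1) 1 + N 0 1" "N (- 2) 1 = N (- 1) 1 + N (- 1) 0"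
  shows "(a1 = 0 \<or> b1 = 0 \<or> a1 = b1) \<and> (a2 = 0 \<or> b2 = 0 \<or> a2 = b2) \<and> (a3 = 0 \<or> b3 = 0 \<or> a3 = b3)"
proof -
  \<comment> \<open>The three cones tile the upper half-plane, which every line through the origin
    meets. A kink line avoiding their interiors runs along (1,0), (0,1) or (-1,1), that is, a = 0, b
    = 0 or a = b.\<close>
  have line: "a = 0 \<or> b = 0 \<or> a = b"
    if "relu (a + b) = relu a + relu b" "relu ((b - a) + b) = relu (b - a) + relu b"
      "relu ((b - a) + - a) = relu (b - a) + relu (- a)" for a b :: real
    using that unfolding relu_add_eq_iff by auto
  have 1: "relu (a1 + b1) + relu (a2 + b2) + relu (a3 + b3) =
      (relu a1 + relu b1) + (relu a2 + relu b2) + (relu a3 + relu b3)"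
    using assms(2) by (simp add: N_def)
  have 2: "relu ((b1 - a1) + b1) + relu ((b2 - a2) + b2) + relu ((b3 - a3) + b3) =
      (relu (b1 - a1) + relu b1) + (relu (b2 - a2) + relu b2) + (relu (b3 - a3) + relu b3)"
    using assms(3) by (simp add: N_def algebra_simps)
  have 3: "relu ((b1 - a1) + - a1) + relu ((b2 - a2) + - a2) + relu ((b3 - a3) + - a3) =
      (relu (b1 - a1) + relu (- a1)) + (relu (b2 - a2) + relu (- a2)) + (relu (b3 - a3) + relu (- a3))"
    using assms(4) by (simp add: N_def algebra_simps)
  \<comment> \<open>Each neuron is subadditive, so equality for the sum of three forces equality for
    each of them.\<close>
  show ?thesis
    using 1 2 3
      relu_add_le[of a1 b1] relu_add_le[of a2 b2] relu_add_le[of a3 b3]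
      relu_add_le[of "b1 - a1" b1] relu_add_le[of "b2 - a2" b2] relu_add_le[of "b3 - a3" b3]
      relu_add_le[of "b1 - a1" "- a1"] relu_add_le[of "b2 - a2" "- a2"] relu_add_le[of "b3 - a3" "- a3"]
    by (intro conjI; intro line; linarith)
qed

lemma relu_rows_determined:
  fixes a1 a2 a3 b1 b2 b3 e :: real
  assumes lines: "a1 = 0 \<or> b1 = 0 \<or> a1 = b1" "a2 = 0 \<or> b2 = 0 \<or> a2 = b2" "a3 = 0 \<or> b3 = 0 \<or> a3 = b3"
    and e: "e > 0"
    and "relu a1 + relu a2 + relu a3 = 20 + e"
    and "relu (- a1) + relu (- a2) + relu (- a3) = 20"
    and "relu b1 + relu b2 + relu b3 = 20"
    and "relu (- b1) + relu (- b2) + relu (- b3) = 20"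
    and "relu (a1 - b1) + relu (a2 - b2) + relu (a3 - b3) = 20 + e"
    and "relu (b1 - a1) + relu (b2 - a2) + relu (b3 - a3) = 20"
  shows "a1 + b1 \<in> {20 + e, 20, - 40}"
proof -
  \<comment> \<open>u, v, x, y, z, w are the coefficients of relu of s, -s, t, -t, s + t, -s-t; a row contributes to
     only one of them. Unless the total of u is 20 + e, four of the totals are nonzero, which three
     rows cannot achieve.\<close>
  define R where "R a b u v x y z w \<longleftrightarrow> (relu a = u + z \<and> relu (- a) = v + w \<and> relu b = x + z \<and>
    relu (- b) = y + w \<and> relu (a - b) = u + y \<and> relu (b - a) = v + x \<and>
    a + b = u - v + x - y + 2 * z - 2 * w \<and>
    u \<ge> 0 \<and> v \<ge> 0 \<and> x \<ge> 0 \<and> y \<ge> 0 \<and> z \<ge> 0 \<and> w \<ge> 0)" for a b u v x y z w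
  define S where "S u v x y z w \<longleftrightarrow>
    (v = 0 \<and> x = 0 \<and> y = 0 \<and> z = 0 \<and> w = 0) \<or> (u = 0 \<and> x = 0 \<and> y = 0 \<and> z = 0 \<and> w = 0) \<or>
    (u = 0 \<and> v = 0 \<and> y = 0 \<and> z = 0 \<and> w = 0) \<or> (u = 0 \<and> v = 0 \<and> x = 0 \<and> z = 0 \<and> w = 0) \<or>
    (u = 0 \<and> v = 0 \<and> x = 0 \<and> y = 0 \<and> w = 0) \<or> (u = 0 \<and> v = 0 \<and> x = 0 \<and> y = 0 \<and> z = 0)"
    for u v x y z w :: real
  have row: "\<exists>u v x y z w. R a b u v x y z w \<and> S u v x y z w"
    if "a = 0 \<or> b = 0 \<or> a = b" for a b
    using that
  proof (elim disjE)
    assume "b = 0"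
    then have "R a b (relu a) (relu (- a)) 0 0 0 0 \<and> S (relu a) (relu (- a)) 0 0 0 0"
      by (auto simp: R_def S_def relu_def)
    then show ?thesis by blast
  next
    assume "a = 0"
    then have "R a b 0 0 (relu b) (relu (- b)) 0 0 \<and> S 0 0 (relu b) (relu (- b)) 0 0"
      by (auto simp: R_def S_def relu_def)
    then show ?thesis by blast
  next
    assume "a = b"
    then have "R a b 0 0 0 0 (relu b) (relu (- b)) \<and> S 0 0 0 0 (relu b) (relu (- b))"
      by (auto simp: R_def S_def relu_def)
    then show ?thesis by blast
  qed
  obtain u1 v1 x1 y1 z1 w1 where 1: "R a1 b1 u1 v1 x1 y1 z1 w1" "S u1 v1 x1 y1 z1 w1" using row[OF lines(1)] by blast
  obtain u2 v2 x2 y2 z2 w2 where 2: "R a2 b2 u2 v2 x2 y2 z2 w2" "S u2 v2 x2 y2 z2 w2" using row[OF lines(2)] by blast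
  obtain u3 v3 x3 y3 z3 w3 where 3: "R a3 b3 u3 v3 x3 y3 z3 w3" "S u3 v3 x3 y3 z3 w3" using row[OF lines(3)] by blast
  note R = 1(1)[unfolded R_def] 2(1)[unfolded R_def] 3(1)[unfolded R_def]
  define X where "X = u1 + u2 + u3"
  \<comment> \<open>The six values leave one free parameter \<open>X\<close> for the six totals,
    because the linear parts of s, t and -s-t cancel.\<close>
  have sums: "z1 + z2 + z3 = 20 + e - X" "y1 + y2 + y3 = 20 + e - X" "v1 + v2 + v3 = 20 + e - X"
    "x1 + x2 + x3 = X - e" "w1 + w2 + w3 = X - e"
    using R assms(5-10) unfolding X_def by linarith+
  have "X \<ge> e" using sums(4) R by linarith
  have "X = 20 + e"
  proof (rule ccontr)
    assume "X \<noteq> 20 + e"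
    moreover have "z1 + z2 + z3 \<ge> 0" using R by linarith
    ultimately have "z1 + z2 + z3 \<noteq> 0" "y1 + y2 + y3 \<noteq> 0" "v1 + v2 + v3 \<noteq> 0" "u1 + u2 + u3 \<noteq> 0"
      using sums X_def \<open>X \<ge> e\<close> e by auto
    then have "z1 \<noteq> 0 \<or> z2 \<noteq> 0 \<or> z3 \<noteq> 0" "y1 \<noteq> 0 \<or> y2 \<noteq> 0 \<or> y3 \<noteq> 0"
      "v1 \<noteq> 0 \<or> v2 \<noteq> 0 \<or> v3 \<noteq> 0" "u1 \<noteq> 0 \<or> u2 \<noteq> 0 \<or> u3 \<noteq> 0"
      by auto
    then show False using 1(2) 2(2) 3(2) unfolding S_def by argo
  qed
  with sums have s: "u1 + u2 + u3 = 20 + e" "x1 + x2 + x3 = 20" "w1 + w2 + w3 = 20"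
    "z1 + z2 + z3 = 0" "y1 + y2 + y3 = 0" "v1 + v2 + v3 = 0" by (auto simp: X_def)
  have zero: "z1 = 0" "y1 = 0" "v1 = 0" using s(4-6) R by linarith+
  have p: "a1 + b1 = u1 + x1 - 2 * w1" using R(1) zero by simp
  have ne: "u1 + u2 + u3 \<noteq> 0" "x1 + x2 + x3 \<noteq> 0" "w1 + w2 + w3 \<noteq> 0" using s e by auto
  \<comment> \<open>Three nonzero totals are distributed over three rows with at most one
    coefficient each, so row 1 carries exactly one total, and all of it.\<close>
  consider "u2 = 0" "u3 = 0" "x1 = 0" "w1 = 0" | "x2 = 0" "x3 = 0" "u1 = 0" "w1 = 0"
    | "w2 = 0" "w3 = 0" "u1 = 0" "x1 = 0"
  proof -
    have "u1 \<noteq> 0 \<or> u2 \<noteq> 0 \<or> u3 \<noteq> 0" "x1 \<noteq> 0 \<or> x2 \<noteq> 0 \<or> x3 \<noteq> 0" "w1 \<noteq> 0 \<or> w2 \<noteq> 0 \<or> w3 \<noteq> 0"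
      using ne by auto
    then have "(u2 = 0 \<and> u3 = 0 \<and> x1 = 0 \<and> w1 = 0) \<or> (x2 = 0 \<and> x3 = 0 \<and> u1 = 0 \<and> w1 = 0) \<or>
      (w2 = 0 \<and> w3 = 0 \<and> u1 = 0 \<and> x1 = 0)"
      using 1(2) 2(2) 3(2) unfolding S_def by argo
    then show ?thesis using that by blast
  qed
  then show ?thesis using s p by cases auto
qed

section \<open>The training data\<close>

text \<open>The first six points span the rays of the lines s = 0, t = 0, s + t = 0; the last three
  are sums of neighbouring rays and test additivity.\<close>

definition sample_points :: "(int \<times> int) list" where
  "sample_points = [(1, 0), (- 1, 0), (0, 1), (0, - 1), (1, - 1), (- 1, 1), (1, 1), (- 1, 2), (- 2, 1)]"

definition target :: "real \<Rightarrow> real \<Rightarrow> real \<Rightarrow> real" where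
  "target e s t = 20 * (relu s + relu t + relu (- s - t)) + relu (e * s)"

text \<open>
  In the coordinates (s, t) of the input (s, t - s, 0), a row (p, q, *) of the weight matrix acts as
  (p - q) s + q t. The change of coordinates makes the first column of a fitting matrix consist of
  approximations of 20, 20 and -40 (in some order) or of -20, -20 and 40, so that the sign of e can
  be read off from each entry.
\<close>

definition sample_data :: "('d \<Rightarrow> int \<times> int) \<Rightarrow> real \<Rightarrow> ((real^3) \<times> real)^'d::finite" where
  "sample_data pt e = (\<chi> i. (vector [of_int (fst (pt i)), of_int (snd (pt i) - fst (pt i)), 0],
     target e (of_int (fst (pt i))) (of_int (snd (pt i)))))"

definition network :: "real^3^3 \<Rightarrow> real \<Rightarrow> real \<Rightarrow> real" where
  "network \<Phi> s t = (\<Sum>k\<in>UNIV. relu ((\<Phi> $ k $ 1 - \<Phi> $ k $ 2) * s + \<Phi> $ k $ 2 * t))"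

lemma loss_sample_data:
  "loss (sample_data pt e) \<Phi> = (\<Sum>i\<in>UNIV. (network \<Phi> (of_int (fst (pt i))) (of_int (snd (pt i)))
     - target e (of_int (fst (pt i))) (of_int (snd (pt i))))\<^sup>2)"
proof -
  have "(\<Phi> *v vector [s, t - s, 0]) $ k = (\<Phi> $ k $ 1 - \<Phi> $ k $ 2) * s + \<Phi> $ k $ 2 * t" for k and s t :: real
    by (simp add: matrix_vector_mult_def sum_3 algebra_simps)
  then show ?thesis
    by (simp add: loss_def sample_data_def network_def)
qed

text \<open>A direction (a, b) in the coordinates (s, t) becomes the row (a + b, b, 0).\<close>

definition fitting_matrix :: "real \<Rightarrow> real^3^3" where
  "fitting_matrix e = (if e \<ge> 0
     then vector [vector [20 + e, 0, 0], vector [20, 20, 0], vector [- 40, - 20, 0]]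
     else vector [vector [- 20 + e, 0, 0], vector [- 20, - 20, 0], vector [40, 20, 0]])"

lemma network_fitting_matrix: "network (fitting_matrix e) s t = target e s t"
proof (cases "e \<ge> 0")
  case True
  have "relu ((20 + e) * s) = (20 + e) * relu s" "relu (20 * t) = 20 * relu t"
    "relu (20 * (- s - t)) = 20 * relu (- s - t)" "relu (e * s) = e * relu s"
    by (rule relu_mult_left, use True in simp)+
  then show ?thesis
    using True by (simp add: network_def fitting_matrix_def target_def sum_3 algebra_simps)
next
  case False
  have "relu ((20 - e) * (- s)) = (20 - e) * relu (- s)" "relu (20 * (- t)) = 20 * relu (- t)"
    "relu (20 * (- (- s - t))) = 20 * relu (- (- s - t))" "relu ((- e) * (- s)) = (- e) * relu (- s)"
    by (rule relu_mult_left, use False in simp)+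
  \<comment> \<open>The linear remainders -s, -t and s + t of the mirrored neurons, each taken 20
    times, cancel.\<close>
  then have "relu ((- 20 + e) * s) = (20 - e) * (relu s - s)" "relu (- 20 * t) = 20 * (relu t - t)"
    "relu (20 * s + 20 * t) = 20 * (relu (- s - t) - (- s - t))" "relu (e * s) = (- e) * (relu s - s)"
    by (simp_all only: relu_uminus) (simp_all add: algebra_simps)
  then show ?thesis
    using False by (simp add: network_def fitting_matrix_def target_def sum_3 algebra_simps)
qed

lemma relu_mult_split: "relu (e * s) = relu s * relu e + relu (- s) * relu (- e)"
proof (cases "s \<ge> 0")
  case True
  then show ?thesis using relu_mult_left[of s e] by (simp add: relu_def mult.commute)
next
  case False
  then show ?thesis using relu_mult_left[of "- s" "- e"] by (simp add: relu_def mult.commute)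
qed

lemma target_computable:
  fixes s t :: int
  assumes "\<bar>s\<bar> \<le> 2"
  shows "computable_real_seq (\<lambda>n. target (diag_real n) s t)" "computable_real (target (diag_real n) s t)"
proof -
  let ?c = "20 * (nat s + nat t + nat (- s - t))"
  have relu_int: "relu (real_of_int z) = real (nat z)" for z by (simp add: relu_def)
  have "(\<lambda>n. target (diag_real n) s t) = diag_combination 0 ?c (nat s) (nat (- s))"
    using relu_int[of s] relu_int[of "- s"] relu_int[of t] relu_int[of "- s - t"]
    by (simp add: fun_eq_iff target_def diag_combination_def relu_mult_split)
  moreover have "nat s \<le> 2" "nat (- s) \<le> 2" using assms by auto
  ultimately show "computable_real_seq (\<lambda>n. target (diag_real n) s t)" "computable_real (target (diag_real n) s t)"
    using computable_diag_combination[of "nat s" "nat (- s)" 0 ?c] by metis+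
qed

lemma vector_3_computable:
  assumes "computable_real x" "computable_real y" "computable_real z"
  shows "computable_real (vector [x, y, z] $ (j :: 3))"
  using assms exhaust_3[of j] by auto

lemma sample_data_computable:
  fixes pt :: "'d::finite \<Rightarrow> int \<times> int"
  assumes "\<And>i. \<bar>fst (pt i)\<bar> \<le> 2"
  shows "computable_seq (\<lambda>n. sample_data pt (diag_real n))" "sample_data pt (diag_real n) \<in> computable_points"
proof -
  have "computable_real_seq (\<lambda>n. vector [real_of_int x, real_of_int y, 0] $ (j :: 3))" for x y j
    using exhaust_3[of j] computable_of_int(1)[of x] computable_of_int(1)[of y] computable_of_int(1)[of 0] by auto
  then show "computable_seq (\<lambda>n. sample_data pt (diag_real n))"
    using target_computable(1)[OF assms] by (simp add: computable_seq_data_iff sample_data_def del: of_int_diff)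
  have "computable_real (vector [real_of_int x, real_of_int y, 0] $ (j :: 3))" for x y j
    using computable_of_int(2)[of x] computable_of_int(2)[of y] computable_of_int(2)[of 0]
    by (intro vector_3_computable) auto
  then show "sample_data pt (diag_real n) \<in> computable_points"
    using target_computable(2)[OF assms] by (simp add: computable_points_data_iff sample_data_def del: of_int_diff)
qed

text \<open>Computability is claimed for each single \<open>n\<close> only, so the case distinction
  on the sign need not be effective.\<close>

lemma fitting_matrix_computable: "fitting_matrix (diag_real n) \<in> computable_points"
proof -
  have const: "computable_real 0" "computable_real 20" "computable_real (- 20)" "computable_real 40"
    "computable_real (- 40)"
    using computable_of_int(2)[of 0] computable_of_int(2)[of 20] computable_of_int(2)[of "- 20"]
      computable_of_int(2)[of 40] computable_of_int(2)[of "- 40"] by simp_all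
  have pos: "computable_real (20 + diag_real n)" if "diag_real n \<ge> 0"
  proof -
    have "20 + diag_real n = diag_combination 0 20 1 0 n" using that by (simp add: diag_combination_def relu_def)
    then show ?thesis using computable_diag_combination(2)[of 1 0] by simp
  qed
  have neg: "computable_real (- 20 + diag_real n)" if "\<not> diag_real n \<ge> 0"
  proof -
    have "- 20 + diag_real n = diag_combination 1 20 0 1 n" using that by (simp add: diag_combination_def relu_def)
    then show ?thesis using computable_diag_combination(2)[of 0 1] by simp
  qed
  show ?thesis
    unfolding computable_points_matrix_iff
  proof (intro allI)
    fix i j :: 3
    show "computable_real (fitting_matrix (diag_real n) $ i $ j)"
      using exhaust_3[of i] exhaust_3[of j] const pos neg by (auto simp: fitting_matrix_def)
  qed
qed

text \<open>The computable \<open>fitting_matrix\<close> attains loss 0, so every minimizer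
  interpolates exactly.\<close>

lemma Opt_sample_data:
  fixes pt :: "'d::finite \<Rightarrow> int \<times> int"
  assumes "\<Phi> \<in> Opt (sample_data pt (diag_real n))"
  shows "network \<Phi> (of_int (fst (pt i))) (of_int (snd (pt i))) =
    target (diag_real n) (of_int (fst (pt i))) (of_int (snd (pt i)))"
proof -
  let ?D = "sample_data pt (diag_real n)"
  have "loss ?D (fitting_matrix (diag_real n)) = 0"
    by (simp add: loss_sample_data network_fitting_matrix)
  then have "loss ?D \<Phi> \<le> 0"
    using assms fitting_matrix_computable[of n] by (force simp: Opt_def is_arg_min_def)
  moreover have "loss ?D \<Phi> \<ge> 0" unfolding loss_sample_data by (intro sum_nonneg) simp
  ultimately have "loss ?D \<Phi> = 0" by simp
  then show ?thesis unfolding loss_sample_data by (simp add: sum_nonneg_eq_0_iff)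
qed

lemma fitting_corner_entry:
  assumes fit: "\<And>s t. (s, t) \<in> set sample_points \<Longrightarrow> network \<Phi> (of_int s) (of_int t) = target e (of_int s) (of_int t)"
  shows "e > 0 \<Longrightarrow> \<Phi> $ 1 $ 1 \<in> {20 + e, 20, - 40}" "e < 0 \<Longrightarrow> \<Phi> $ 1 $ 1 \<in> {- 20 + e, - 20, 40}"
proof -
  define a where "a k = \<Phi> $ k $ 1 - \<Phi> $ k $ 2" for k
  define b where "b k = \<Phi> $ k $ 2" for k
  have N: "relu (a 1 * s + b 1 * t) + relu (a 2 * s + b 2 * t) + relu (a 3 * s + b 3 * t) = network \<Phi> s t" for s t
    by (simp add: network_def sum_3 a_def b_def)
  have v: "network \<Phi> 1 0 = 20 + relu e" "network \<Phi> (- 1) 0 = 20 + relu (- e)" "network \<Phi> 0 1 = 20"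
    "network \<Phi> 0 (- 1) = 20" "network \<Phi> 1 (- 1) = 20 + relu e" "network \<Phi> (- 1) 1 = 20 + relu (- e)"
    "network \<Phi> 1 1 = 40 + relu e" "network \<Phi> (- 1) 2 = 40 + relu (- e)"
    "network \<Phi> (- 2) 1 = 40 + 2 * relu (- e)"
    using fit[of 1 0] fit[of "- 1" 0] fit[of 0 1] fit[of 0 "- 1"] fit[of 1 "- 1"] fit[of "- 1" 1]
      fit[of 1 1] fit[of "- 1" 2] fit[of "- 2" 1] relu_mult_left[of 2 "- e"]
    by (simp_all add: sample_points_def target_def relu_def mult.commute)
  have lines: "(a 1 = 0 \<or> b 1 = 0 \<or> a 1 = b 1) \<and> (a 2 = 0 \<or> b 2 = 0 \<or> a 2 = b 2) \<and> (a 3 = 0 \<or> b 3 = 0 \<or> a 3 = b 3)"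
    by (rule relu_rows_on_lines; simp only: N v; simp)
  have u: "relu (a 1) + relu (a 2) + relu (a 3) = 20 + relu e"
    "relu (- a 1) + relu (- a 2) + relu (- a 3) = 20 + relu (- e)"
    "relu (b 1) + relu (b 2) + relu (b 3) = 20"
    "relu (- b 1) + relu (- b 2) + relu (- b 3) = 20"
    "relu (a 1 - b 1) + relu (a 2 - b 2) + relu (a 3 - b 3) = 20 + relu e"
    "relu (b 1 - a 1) + relu (b 2 - a 2) + relu (b 3 - a 3) = 20 + relu (- e)"
    using v N[of 1 0] N[of "- 1" 0] N[of 0 1] N[of 0 "- 1"] N[of 1 "- 1"] N[of "- 1" 1] by simp_all
  have ab: "\<Phi> $ 1 $ 1 = a 1 + b 1" by (simp add: a_def b_def)
  show "\<Phi> $ 1 $ 1 \<in> {20 + e, 20, - 40}" if "e > 0"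
  proof -
    have "relu e = e" "relu (- e) = 0" using that by (simp_all add: relu_def)
    then show ?thesis
      unfolding ab using lines u that
      by (intro relu_rows_determined[where ?a2.0 = "a 2" and ?b2.0 = "b 2" and ?a3.0 = "a 3" and ?b3.0 = "b 3"]) auto
  qed
  show "\<Phi> $ 1 $ 1 \<in> {- 20 + e, - 20, 40}" if "e < 0"
  proof -
    have "relu e = 0" "relu (- e) = - e" using that by (simp_all add: relu_def)
    \<comment> \<open>Negating all rows swaps the values at antipodal points and thereby replaces e
      by -e.\<close>
    then have "- a 1 + - b 1 \<in> {20 + - e, 20, - 40}"
      using lines u that
      by (intro relu_rows_determined[where ?a2.0 = "- a 2" and ?b2.0 = "- b 2" and ?a3.0 = "- a 3" and ?b3.0 = "- b 3"]) auto
    then show ?thesis unfolding ab by auto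
  qed
qed

section \<open>The contradiction for functions close to a minimizer\<close>

lemma sample_indexing_exists:
  assumes "CARD('d::finite) \<ge> 14"
  shows "\<exists>pt :: 'd \<Rightarrow> int \<times> int. range pt = set sample_points"
proof -
  have le: "card (set sample_points) \<le> card (UNIV :: 'd set)"
    using card_length[of sample_points] assms by (simp add: sample_points_def)
  then obtain h :: "int \<times> int \<Rightarrow> 'd" where h: "inj_on h (set sample_points)"
    using card_le_inj[OF finite_set finite le] by blast
  \<comment> \<open>Indices left over repeat the sample (1, 0), which adds no constraint.\<close>
  let ?pt = "\<lambda>i. if i \<in> h ` set sample_points then inv_into (set sample_points) h i else (1, 0)"
  have "range ?pt = set sample_points"
  proof (intro equalityI subsetI)
    fix x assume "x \<in> range ?pt"
    then obtain i where "x = ?pt i" by blast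
    moreover have "(1, 0) \<in> set sample_points" by (simp add: sample_points_def)
    ultimately show "x \<in> set sample_points"
      using inv_into_into[of i h "set sample_points"] by presburger
  next
    fix x assume "x \<in> set sample_points"
    then have "x = ?pt (h x)" using inv_into_f_f[OF h] by simp
    then show "x \<in> range ?pt" by (rule range_eqI)
  qed
  then show ?thesis by blast
qed

text \<open>The intervals surround the possible corner entries with margin 5, and |e| at most 1
  extends 20 - 5 to 20 + 6. The quotient is 1 for sizes near 40 and 0 for those near 20, so it flips
  the parity exactly where the sign of \<open>r\<close> alone would mislead.\<close>

lemma approximation_parity:
  assumes "q \<noteq> 0" and r: "r = (- 1) ^ s * (real p / real q)"
  shows "15 < r \<and> r < 26 \<or> - 45 < r \<and> r < - 35 \<Longrightarrow> even (s + p div (30 * q))"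
    and "- 26 < r \<and> r < - 15 \<or> 35 < r \<and> r < 45 \<Longrightarrow> odd (s + p div (30 * q))"
proof -
  define x where "x = real p / real q"
  have x: "x \<ge> 0" "real p = x * real q" using assms(1) by (simp_all add: x_def)
  have small: "p div (30 * q) = 0" if "x < 26"
  proof -
    have "real p < 30 * real q" using x that assms(1) by (simp add: mult_strict_right_mono)
    then have "p < 30 * q" by linarith
    then show ?thesis by simp
  qed
  have large: "p div (30 * q) = 1" if "35 < x" "x < 45"
  proof -
    have "30 * real q < real p" "real p < 60 * real q" using x that assms(1) by (simp_all add: mult_strict_right_mono)
    then have "30 * q \<le> p" "p < 2 * (30 * q)" by linarith+
    then show ?thesis using assms(1) by (intro div_nat_eqI) auto
  qed
  have "r = (if even s then x else - x)" using r by (simp add: x_def)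
  then show "15 < r \<and> r < 26 \<or> - 45 < r \<and> r < - 35 \<Longrightarrow> even (s + p div (30 * q))"
    "- 26 < r \<and> r < - 15 \<or> 35 < r \<and> r < 45 \<Longrightarrow> odd (s + p div (30 * q))"
    using x(1) small large by (auto split: if_splits)
qed

lemma abs_diag_real_le: "\<bar>diag_real n\<bar> \<le> 1"
proof -
  have "\<bar>(if c then - 1 else 1) / real (diag_weight n 0)\<bar> \<le> 1" for c
    by (simp add: diag_weight_def)
  then show ?thesis using diag_real_approx[of n 0] by auto
qed

lemma not_computable_near_minimizers:
  fixes G H :: "((real^3) \<times> real)^'d::finite \<Rightarrow> real^3^3"
  assumes "CARD('d) \<ge> 14"
    and G: "\<And>D. D \<in> computable_points \<Longrightarrow> G D \<in> Opt D"
    and close: "\<And>D. D \<in> computable_points \<Longrightarrow> \<bar>G D $ 1 $ 1 - H D $ 1 $ 1\<bar> < 4"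
  shows "\<not> banach_mazur_computable_on computable_points H"
proof
  assume H: "banach_mazur_computable_on computable_points H"
  obtain pt :: "'d \<Rightarrow> int \<times> int" where pt: "range pt = set sample_points"
    using sample_indexing_exists[OF assms(1)] by blast
  have "\<forall>x\<in>set sample_points. \<bar>fst x\<bar> \<le> 2" by (simp add: sample_points_def)
  then have "\<bar>fst (pt i)\<bar> \<le> 2" for i using pt by blast
  note D = sample_data_computable[of pt, OF this]
  let ?D = "\<lambda>n. sample_data pt (diag_real n)"
  have "computable_seq (\<lambda>n. H (?D n))"
    using H[unfolded banach_mazur_computable_on_def, rule_format, of ?D] D by simp
  then have "computable_real_seq (\<lambda>n. H (?D n) $ 1 $ 1)" unfolding computable_seq_matrix_iff by blast
  then obtain r where r: "computable_rat_double_seq r" "\<And>n k. \<bar>of_rat (r n k) - H (?D n) $ 1 $ 1\<bar> \<le> 1 / 2 ^ k"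
    unfolding computable_real_seq_def by blast
  then obtain s p q where spq: "recursive2 s" "recursive2 p" "recursive2 q" "\<And>n k. q n k \<noteq> 0"
    "\<And>n k. r n k = (- 1) ^ s n k * (of_nat (p n k) / of_nat (q n k))"
    unfolding computable_rat_double_seq_def by blast
  obtain n where n: "diag_real n \<noteq> 0" "diag_real n > 0 \<longleftrightarrow> odd (s n 0 + p n 0 div (30 * q n 0))"
    using diag_real_defeats[OF spq(1-3)] by blast
  define x where "x = real_of_rat (r n 0)"
  have x: "x = (- 1) ^ s n 0 * (real (p n 0) / real (q n 0))"
    by (simp add: x_def spq(5) of_rat_mult of_rat_divide of_rat_power of_rat_minus)
  \<comment> \<open>The approximation with index 0 contributes at most 1, the distance of
    \<open>H\<close> from \<open>G\<close> less than 4.\<close>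
  have near: "\<bar>x - G (?D n) $ 1 $ 1\<bar> < 5"
    using r(2)[of n 0] close[OF D(2)[of n]] by (simp add: x_def)
  have fit: "network (G (?D n)) (of_int s) (of_int t) = target (diag_real n) (of_int s) (of_int t)"
    if st: "(s, t) \<in> set sample_points" for s t
  proof -
    obtain i where "pt i = (s, t)" using pt st by (metis imageE)
    then show ?thesis using Opt_sample_data[OF G[OF D(2)[of n]], of i] by simp
  qed
  have e1: "\<bar>diag_real n\<bar> \<le> 1" by (rule abs_diag_real_le)
  show False
  proof (cases "diag_real n > 0")
    case True
    have "15 < x \<and> x < 26 \<or> - 45 < x \<and> x < - 35"
      using fitting_corner_entry(1)[OF fit True] near e1 True by (auto simp: abs_less_iff)
    from approximation_parity(1)[OF spq(4) x this] show False using n True by simp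
  next
    case False
    then have neg: "diag_real n < 0" using n(1) by simp
    from fitting_corner_entry(2)[OF fit neg] have "- 26 < x \<and> x < - 15 \<or> 35 < x \<and> x < 45"
      using near e1 neg by (auto simp: abs_less_iff)
    from approximation_parity(2)[OF spq(4) x this] show False using n False by simp
  qed
qed

lemma abs_entry_le_matrix_l1_norm: "\<bar>A $ i $ j\<bar> \<le> matrix_l1_norm A"
proof -
  have "\<bar>A $ i $ j\<bar> \<le> (\<Sum>j\<in>UNIV. \<bar>A $ i $ j\<bar>)" by (rule member_le_sum) auto
  also have "\<dots> \<le> matrix_l1_norm A"
    unfolding matrix_l1_norm_def by (rule member_le_sum) (auto intro: sum_nonneg)
  finally show ?thesis .
qed

theorem theorem2:
  fixes G :: "((real^3) \<times> real)^'d::finite \<Rightarrow> real^3^3"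
  assumes "CARD('d) \<ge> 14"
    and "\<And>D. D \<in> computable_points \<Longrightarrow> G D \<in> Opt D"
  shows "\<not> banach_mazur_computable_on computable_points G \<and>
    (\<forall>H :: ((real^3) \<times> real)^'d \<Rightarrow> real^3^3.
       (\<forall>D\<in>computable_points. H D \<in> computable_points) \<and>
       (\<exists>\<alpha>::real. \<alpha> < 4 \<and> sup_dist G H \<le> ereal \<alpha>) \<longrightarrow>
       \<not> banach_mazur_computable_on computable_points H)"
proof (intro conjI allI impI)
  \<comment> \<open>\<open>G\<close> is its own approximation, with distance 0.\<close>
  show "\<not> banach_mazur_computable_on computable_points G"
    using assms by (rule not_computable_near_minimizers) auto
  fix H :: "((real^3) \<times> real)^'d \<Rightarrow> real^3^3"
  assume "(\<forall>D\<in>computable_points. H D \<in> computable_points) \<and>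
    (\<exists>\<alpha>::real. \<alpha> < 4 \<and> sup_dist G H \<le> ereal \<alpha>)"
  then obtain \<alpha> where \<alpha>: "\<alpha> < 4" "sup_dist G H \<le> ereal \<alpha>" by blast
  have "\<bar>G D $ 1 $ 1 - H D $ 1 $ 1\<bar> < 4" if "D \<in> computable_points" for D
  proof -
    have "ereal (matrix_l1_norm (G D - H D)) \<le> sup_dist G H"
      unfolding sup_dist_def using that by (rule SUP_upper)
    then have "matrix_l1_norm (G D - H D) \<le> \<alpha>" using \<alpha>(2) order_trans ereal_less_eq(3) by blast
    then show ?thesis using abs_entry_le_matrix_l1_norm[of "G D - H D" 1 1] \<alpha>(1) by simp
  qed
  with assms show "\<not> banach_mazur_computable_on computable_points H"
    by (rule not_computable_near_minimizers)
qed

end
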